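(* Let $r$ be a positive integer. Then \begin{align*} \Psi^t_0 & = \frac{(1+(1-q)u_1)^2}{1-qu_1 - t (1-qu_1) \sum_{k=2}^{r+1}q^{k-2} u_k -tq^r u_{r+2}} \\ & \quad \times \sum_{j=0}^{r-1} A_j \widetilde{B_j} \ {}_{r+2} \phi _{r+1} \left[ \begin{array}{c} q^{j+1}, a_1q^j, \ldots, a_{r+1}q^j \\ b_1q^j, \ldots, b_{r+1}q^j \end{array} ; q, \frac{b_1 \cdots b_{r+1}}{q^r a_1 \cdots a_{r+1}} \right], \end{align*} where $$A_j = \sum_{m=j}^{r-1} c_m S_q(m+1, j+1) + \frac{u_1u_2}{(1+(1-q)u_1)^2} S_q(r, j+1), \quad j=0, \ldots, r-1,$$ with \begin{align*} c_m = & \sum_{k=r-m+1}^{r+1}\left\{\binom{k-2}{r-m}+\frac{(1-q)u_1}{1+(1-q)u_1}\binom{k-2}{r-m-1}\right\}(-(1-q))^{k-r+m-2}\\ & \times \left(\frac{u_k}{1+(1-q)u_1}-u_1^{k-r-2}u_{r+2}+\frac{(1-q)u_{k+1}}{1+(1-q)u_1}\right), \end{align*} and $$\widetilde{B_j} = q \cdot \frac{(q, a_1, \ldots, a_{r+1}; q)_j}{(b_1, \ldots, b_{r+1}; q)_j} \left( \frac{b_1 \cdots b_{r+1}}{q^r (1-q) a_1 \cdots a_{r+1}} \right)^j, \quad j=0, \ldots, r-1.$$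
   Context: $q$ is a formal parameter and $[n]=(1-q^n)/(1-q)$. For an index $\mathbf k=(k_1,\dots,k_l)$ of positive integers, its weight is $k_1+\dots+k_l$, its depth is $l$, and its $i$-height is $\#\{j : k_j\ge i+1\}$; it is admissible if $k_1\ge 2$. Define $\zeta_q(\mathbf k)=\sum_{m_1>\cdots>m_l\ge1}\prod_{j=1}^l q^{(k_j-1)m_j}/[m_j]^{k_j}$ and the interpolated $q$-multiple zeta value $\zeta^t_q(\mathbf k)=\sum_{\mathbf p}(1-q)^{k-\mathrm{wt}(\mathbf p)}\zeta_q(\mathbf p)t^{l-\mathrm{dep}(\mathbf p)}$, where $k=k_1+\cdots+k_l$ and $\mathbf p$ runs over all indices of the form $(k_1\,\square\,k_2\,\square\cdots\square\,k_l)$ in which each $\square$ is independently filled by ``$,$'' or ``$+$'' or ``$-1+$'' (the last meaning two neighbouring entries $a,b$ are replaced by $a+b-1$). The $q$-shifted factorial is $(a;q)_0=1$, $(a;q)_n=(1-a)(1-aq)\cdots(1-aq^{n-1})$, $(a_1,\dots,a_m;q)_n=\prod_i (a_i;q)_n$, and ${}_{s+1}\phi_s\left[\begin{array}{c}a_1,\dots,a_{s+1}\\ b_1,\dots,b_s\end{array};q,z\right]=\sum_{n\ge0}\frac{(a_1,\dots,a_{s+1};q)_n}{(q,b_1,\dots,b_s;q)_n}z^n$. For nonnegative integers $k,l,h_1,\dots,h_r$, let $\xi^t_0(k,l,h_1,\dots,h_r)=\sum \zeta^t_q(\mathbf k)$, the sum over admissible indices of weight $k$, depth $l$ and $i$-height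 $h_i$ for $i=1,\dots,r$ (empty sum $=0$), and $\Psi^t_0=\sum_{k,l,h_1,\dots,h_r\ge0}\xi^t_0(k,l,h_1,\dots,h_r)u_1^{k-l-\sum_{j=1}^r h_j}u_2^{l-h_1}u_3^{h_1-h_2}\cdots u_{r+1}^{h_{r-1}-h_r}u_{r+2}^{h_r}$. Put $x_1=u_1/(1+(1-q)u_1)$ and, for $j=2,\dots,r+2$, $x_j=u_1^{-(r+2-j)}\left\{\sum_{k=j}^{r+1}\binom{k-2}{j-2}((q-1)u_1)^{k-j}(u_1^{r+2-k}u_k-u_{r+2})+\frac{u_{r+2}}{(1+(1-q)u_1)^{j-1}}\right\}$. Let $\alpha_1,\dots,\alpha_{r+1}$ be determined by $\sum_i\alpha_i=(1-t)x_2-x_1$ and $e_j(\alpha_1,\dots,\alpha_{r+1})=(1-t)(x_{j+1}-x_1x_j)$ for $j=2,\dots,r+1$ ($e_j$ the elementary symmetric polynomial), and $\beta_1,\dots,\beta_{r+1}$ by $\sum_i\beta_i=-(x_1+tx_2)$ and $e_j(\beta)=-t(x_{j+1}-x_1x_j)$ for $j=2,\dots,r+1$. Put $a_i=q/(1+(1-q)\alpha_i)$ and $b_i=q^2/(1+(1-q)\beta_i)$. The $q$-Stirling numbers of the second kind are defined by $S_q(0,0)=1$, $S_q(n,k)=q^{k-1}S_q(n-1,k-1)+[k]S_q(n-1,k)$ for $0<k\le n$, and $S_q(n,k)=0$ otherwise. *)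

theory Defs
  imports
    "HOL-Analysis.Analysis"
    "HOL-Computational_Algebra.Formal_Power_Series"
    "HOL-Library.Multiset"
begin

section \<open>Multivariate formal power series\<close>

text \<open>
  Formal power series over \<^typ>\<open>'a\<close> in variables indexed by \<^typ>\<open>'v\<close>: a monomial is a finite
  multiset of variables.
\<close>

typedef ('v, 'a) mfps = "UNIV :: ('v multiset \<Rightarrow> 'a) set"
  morphisms mcoeff Abs_mfps ..

lemma mcoeff_Abs [simp]: "mcoeff (Abs_mfps f) M = f M"
  by (simp add: Abs_mfps_inverse)

lemma mfps_eqI: "(\<And>M. mcoeff f M = mcoeff g M) \<Longrightarrow> f = g"
  by (metis ext mcoeff_inject)

lemma finite_msplit [simp]: "finite {(A, B). A + B = (M :: 'v multiset)}"
proof -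
  have "finite {A. A \<subseteq># M}"
  proof (induction M)
    case (add x M)
    have "{A. A \<subseteq># add_mset x M} \<subseteq> {A. A \<subseteq># M} \<union> add_mset x ` {A. A \<subseteq># M}"
    proof
      fix A assume "A \<in> {A. A \<subseteq># add_mset x M}"
      hence *: "A \<subseteq># add_mset x M" by simp
      show "A \<in> {A. A \<subseteq># M} \<union> add_mset x ` {A. A \<subseteq># M}"
      proof (cases "x \<in># A")
        case True
        then obtain A' where "A = add_mset x A'" by (metis insert_DiffM)
        with * show ?thesis by simp
      next
        case False
        with * have "A \<subseteq># M" 
          by (metis (no_types, lifting) diff_single_trivial subset_eq_diff_conv add_mset_add_single)
        thus ?thesis by simp
      qed
    qed
    thus ?case using add by (meson finite_UnI finite_imageI finite_subset)
  qed simp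
  hence "finite ({A. A \<subseteq># M} \<times> {A. A \<subseteq># M})" by simp
  moreover have "{(A, B). A + B = M} \<subseteq> {A. A \<subseteq># M} \<times> {A. A \<subseteq># M}" by auto
  ultimately show ?thesis by (rule finite_subset[rotated])
qed

instantiation mfps :: (type, comm_ring_1) comm_ring_1
begin

definition "0 = Abs_mfps (\<lambda>_. 0)"
definition "1 = Abs_mfps (\<lambda>M. if M = {#} then 1 else 0)"
definition "f + g = Abs_mfps (\<lambda>M. mcoeff f M + mcoeff g M)"
definition "f - g = Abs_mfps (\<lambda>M. mcoeff f M - mcoeff g M)"
definition "- f = Abs_mfps (\<lambda>M. - mcoeff f M)"
definition "f * g = Abs_mfps (\<lambda>M. \<Sum>(A, B) \<in> {(A, B). A + B = M}. mcoeff f A * mcoeff g B)"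

lemmas mfps_defs = zero_mfps_def one_mfps_def plus_mfps_def minus_mfps_def uminus_mfps_def
  times_mfps_def

instance
proof
  fix f g h :: "('a, 'b) mfps"
  show "f * g * h = f * (g * h)"
  proof (rule mfps_eqI)
    fix M
    define S where "S N = {(A, B). A + B = (N :: 'a multiset)}" for N
    have fin: "finite (S N)" for N unfolding S_def by simp
    have "mcoeff (f * g * h) M =
        (\<Sum>p\<in>S M. \<Sum>s\<in>S (fst p). mcoeff f (fst s) * mcoeff g (snd s) * mcoeff h (snd p))"
      by (simp add: times_mfps_def S_def sum_distrib_right case_prod_beta)
    also have "\<dots> = (\<Sum>(p, s)\<in>Sigma (S M) (\<lambda>p. S (fst p)).
        mcoeff f (fst s) * mcoeff g (snd s) * mcoeff h (snd p))"
      by (rule sum.Sigma) (auto simp: fin)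
    also have "\<dots> = (\<Sum>(p, s)\<in>Sigma (S M) (\<lambda>p. S (snd p)).
        mcoeff f (fst p) * (mcoeff g (fst s) * mcoeff h (snd s)))"
      by (rule sum.reindex_bij_witness[of _
            "\<lambda>(p, s). ((fst p + fst s, snd s), (fst p, fst s))"
            "\<lambda>(p, s). ((fst s, snd s + snd p), (snd s, snd p))"])
         (auto simp: S_def algebra_simps)
    also have "\<dots> = (\<Sum>p\<in>S M. \<Sum>s\<in>S (snd p).
        mcoeff f (fst p) * (mcoeff g (fst s) * mcoeff h (snd s)))"
      by (rule sum.Sigma[symmetric]) (auto simp: fin)
    also have "\<dots> = mcoeff (f * (g * h)) M"
      by (simp add: times_mfps_def S_def sum_distrib_left case_prod_beta)
    finally show "mcoeff (f * g * h) M = mcoeff (f * (g * h)) M" .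
  qed
  show "f * g = g * f"
  proof (rule mfps_eqI)
    fix M show "mcoeff (f * g) M = mcoeff (g * f) M"
      unfolding times_mfps_def mcoeff_Abs
      by (rule sum.reindex_bij_witness[of _ prod.swap prod.swap])
         (auto simp: mult.commute add.commute)
  qed
  show "1 * f = f"
  proof (rule mfps_eqI)
    fix M
    have "mcoeff (1 * f) M = (\<Sum>(A, B)\<in>{({#}, M)}. mcoeff (1 :: ('a, 'b) mfps) A * mcoeff f B)"
      unfolding times_mfps_def mcoeff_Abs
      by (rule sum.mono_neutral_right) (auto simp: one_mfps_def split: if_splits)
    thus "mcoeff (1 * f) M = mcoeff f M" by (simp add: one_mfps_def)
  qed
  show "(f + g) * h = f * h + g * h"
    by (rule mfps_eqI) (simp add: times_mfps_def plus_mfps_def sum.distrib[symmetric]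
      case_prod_beta distrib_right)
  show "(0 :: ('a, 'b) mfps) \<noteq> 1"
  proof
    assume "(0 :: ('a, 'b) mfps) = 1"
    hence "mcoeff (0 :: ('a, 'b) mfps) {#} = mcoeff 1 {#}" by simp
    thus False by (simp add: zero_mfps_def one_mfps_def)
  qed
qed (rule mfps_eqI; simp add: mfps_defs algebra_simps)+

end

definition mconst :: "'a::comm_ring_1 \<Rightarrow> ('v, 'a) mfps" where
  "mconst c = Abs_mfps (\<lambda>M. if M = {#} then c else 0)"

definition mvar :: "'v \<Rightarrow> ('v, 'a::comm_ring_1) mfps" where
  "mvar v = Abs_mfps (\<lambda>M. if M = {#v#} then 1 else 0)"

text \<open>
  The parameter \<open>q\<close> is formal: coefficients lie in \<^typ>\<open>rat fps\<close>, where \<open>q\<close> is \<^const>\<open>fps_X\<close>, and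
  \<open>t, u\<^sub>1, u\<^sub>2, \<dots>\<close> are the variables of the power series ring.
\<close>

datatype pvar = T | U nat

type_synonym pseries = "(pvar, rat fps) mfps"

abbreviation "q_ser \<equiv> (mconst fps_X :: pseries)"
abbreviation "t_ser \<equiv> (mvar T :: pseries)"
abbreviation "u_ser i \<equiv> (mvar (U i) :: pseries)"

text \<open>
  The roots \<open>\<alpha>\<^sub>i\<close> and \<open>\<beta>\<^sub>i\<close> do not lie in the power series ring, so the
  main identity is stated in a field containing that ring.
\<close>

definition ring_embedding :: "('a::comm_ring_1 \<Rightarrow> 'b::field) \<Rightarrow> bool" where
  "ring_embedding \<iota> \<longleftrightarrow> inj \<iota> \<and> \<iota> 1 = 1 \<and> (\<forall>x y. \<iota> (x + y) = \<iota> x + \<iota> y) \<and>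
     (\<forall>x y. \<iota> (x * y) = \<iota> x * \<iota> y)"

text \<open>
  A series in the field converges formally if its terms lie in the power series ring and every
  coefficient converges in the \<open>q\<close>-adic topology, which is the library topology of \<^typ>\<open>rat fps\<close>.
\<close>

definition formal_sums :: "(pseries \<Rightarrow> 'l::field) \<Rightarrow> (nat \<Rightarrow> 'l) \<Rightarrow> 'l \<Rightarrow> bool" where
  "formal_sums \<iota> f s \<longleftrightarrow> (\<exists>g G. (\<forall>n. f n = \<iota> (g n)) \<and> s = \<iota> G \<and>
     (\<forall>M. (\<lambda>n. mcoeff (g n) M) sums mcoeff G M))"

definition formal_suminf :: "(pseries \<Rightarrow> 'l::field) \<Rightarrow> (nat \<Rightarrow> 'l) \<Rightarrow> 'l" where
  "formal_suminf \<iota> f = (THE s. formal_sums \<iota> f s)"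


section \<open>Interpolated \<open>q\<close>-multiple zeta values\<close>

definition qint :: "'a::{comm_ring_1, inverse} \<Rightarrow> nat \<Rightarrow> 'a" where
  "qint q n = (1 - q ^ n) / (1 - q)"

definition admissible :: "nat list \<Rightarrow> bool" where
  "admissible ks \<longleftrightarrow> ks \<noteq> [] \<and> (\<forall>k\<in>set ks. k \<ge> 1) \<and> hd ks \<ge> 2"

definition height :: "nat \<Rightarrow> nat list \<Rightarrow> nat" where
  "height i ks = card {j. j < length ks \<and> ks ! j \<ge> i + 1}"

definition zeta_q :: "nat list \<Rightarrow> rat fps" where
  "zeta_q ks = (\<Sum>\<^sub>\<infinity>ms\<in>{ms. length ms = length ks \<and> sorted_wrt (>) ms \<and> (\<forall>m\<in>set ms. m \<ge> 1)}.
     \<Prod>j<length ks. fps_X ^ ((ks ! j - 1) * ms ! j) / qint fps_X (ms ! j) ^ (ks ! j))"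

datatype box = Comma | Plus | MinusOnePlus

fun fill :: "nat list \<Rightarrow> box list \<Rightarrow> nat list" where
  "fill (a # b # ks) (Comma # bs) = a # fill (b # ks) bs"
| "fill (a # b # ks) (Plus # bs) = fill ((a + b) # ks) bs"
| "fill (a # b # ks) (MinusOnePlus # bs) = fill ((a + b - 1) # ks) bs"
| "fill ks _ = ks"

text \<open>
  The sum runs over the fillings of the boxes: an index produced by several fillings is counted
  once for each of them.
\<close>

definition zeta_qt :: "nat list \<Rightarrow> pseries" where
  "zeta_qt ks = (\<Sum>bs\<in>{bs. length bs = length ks - 1}.
     let p = fill ks bs in
       mconst ((1 - fps_X) ^ (sum_list ks - sum_list p) * zeta_q p) * t_ser ^ (length ks - length p))"

text \<open>The list \<open>hs\<close> is \<open>[h\<^sub>1, \<dots>, h\<^sub>r]\<close>; thus \<open>h\<^sub>i\<close> is \<open>hs ! (i - 1)\<close>.\<close>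

definition xi0 :: "nat \<Rightarrow> nat \<Rightarrow> nat list \<Rightarrow> pseries" where
  "xi0 k l hs = (\<Sum>ks\<in>{ks. admissible ks \<and> sum_list ks = k \<and> length ks = l \<and>
     (\<forall>i\<in>{1..length hs}. height i ks = hs ! (i - 1))}. zeta_qt ks)"

text \<open>
  The truncated subtractions in the exponents are harmless: \<^term>\<open>xi0 k l hs\<close> vanishes unless
  \<open>k \<ge> l + h\<^sub>1 + \<dots> + h\<^sub>r\<close> and \<open>l \<ge> h\<^sub>1 \<ge> \<dots> \<ge> h\<^sub>r\<close>.
\<close>

definition u_monomial :: "nat \<Rightarrow> nat \<Rightarrow> nat \<Rightarrow> nat list \<Rightarrow> pseries" where
  "u_monomial r k l hs =
     u_ser 1 ^ (k - l - (\<Sum>j=1..r. hs ! (j - 1))) * u_ser 2 ^ (l - hs ! 0) *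
     (\<Prod>i=1..<r. u_ser (i + 2) ^ (hs ! (i - 1) - hs ! i)) * u_ser (r + 2) ^ (hs ! (r - 1))"

definition Psi0 :: "nat \<Rightarrow> pseries" where
  "Psi0 r = Abs_mfps (\<lambda>M. \<Sum>\<^sub>\<infinity>(k, l, hs)\<in>{(k, l, hs). length hs = r}.
     mcoeff (xi0 k l hs * u_monomial r k l hs) M)"


section \<open>Basic hypergeometric series\<close>

definition qpoch :: "'a::comm_ring_1 \<Rightarrow> 'a \<Rightarrow> nat \<Rightarrow> 'a" where
  "qpoch q a n = (\<Prod>i<n. 1 - a * q ^ i)"

definition qpochs :: "'a::comm_ring_1 \<Rightarrow> 'a list \<Rightarrow> nat \<Rightarrow> 'a" where
  "qpochs q as n = (\<Prod>a\<leftarrow>as. qpoch q a n)"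

definition phi_term :: "'a::field \<Rightarrow> 'a list \<Rightarrow> 'a list \<Rightarrow> 'a \<Rightarrow> nat \<Rightarrow> 'a" where
  "phi_term q as bs z n = qpochs q as n / qpochs q (q # bs) n * z ^ n"

definition phi :: "(pseries \<Rightarrow> 'l::field) \<Rightarrow> 'l \<Rightarrow> 'l list \<Rightarrow> 'l list \<Rightarrow> 'l \<Rightarrow> 'l" where
  "phi \<iota> q as bs z = formal_suminf \<iota> (phi_term q as bs z)"

definition phi_converges :: "(pseries \<Rightarrow> 'l::field) \<Rightarrow> 'l \<Rightarrow> 'l list \<Rightarrow> 'l list \<Rightarrow> 'l \<Rightarrow> bool" where
  "phi_converges \<iota> q as bs z \<longleftrightarrow> (\<exists>s. formal_sums \<iota> (phi_term q as bs z) s)"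


section \<open>The remaining parameters\<close>

definition esym :: "nat \<Rightarrow> nat \<Rightarrow> (nat \<Rightarrow> 'a::comm_ring_1) \<Rightarrow> 'a" where
  "esym n j a = (\<Sum>S\<in>{S. S \<subseteq> {1..n} \<and> card S = j}. \<Prod>i\<in>S. a i)"

fun qStirling :: "'a::field \<Rightarrow> nat \<Rightarrow> nat \<Rightarrow> 'a" where
  "qStirling q 0 0 = 1"
| "qStirling q (Suc n) (Suc k) =
    (if k \<le> n then q ^ k * qStirling q n k + qint q (Suc k) * qStirling q n (Suc k) else 0)"
| "qStirling q 0 (Suc k) = 0"
| "qStirling q (Suc n) 0 = 0"

definition x_par :: "nat \<Rightarrow> 'a::field \<Rightarrow> (nat \<Rightarrow> 'a) \<Rightarrow> nat \<Rightarrow> 'a" where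
  "x_par r q u j =
    (if j = 1 then u 1 / (1 + (1 - q) * u 1)
     else (1 / u 1 ^ (r + 2 - j)) *
       ((\<Sum>k=j..r+1. of_nat ((k - 2) choose (j - 2)) * ((q - 1) * u 1) ^ (k - j) *
            (u 1 ^ (r + 2 - k) * u k - u (r + 2)))
        + u (r + 2) / (1 + (1 - q) * u 1) ^ (j - 1)))"

definition c_par :: "nat \<Rightarrow> 'a::field \<Rightarrow> (nat \<Rightarrow> 'a) \<Rightarrow> nat \<Rightarrow> 'a" where
  "c_par r q u m = (\<Sum>k=r-m+1..r+1.
     (of_nat ((k - 2) choose (r - m))
       + (1 - q) * u 1 / (1 + (1 - q) * u 1) * of_nat ((k - 2) choose (r - m - 1)))
     * (- (1 - q)) powi (int k - int r + int m - 2)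
     * (u k / (1 + (1 - q) * u 1) - u 1 powi (int k - int r - 2) * u (r + 2)
         + (1 - q) * u (k + 1) / (1 + (1 - q) * u 1)))"

definition A_par :: "nat \<Rightarrow> 'a::field \<Rightarrow> (nat \<Rightarrow> 'a) \<Rightarrow> nat \<Rightarrow> 'a" where
  "A_par r q u j = (\<Sum>m=j..r-1. c_par r q u m * qStirling q (m + 1) (j + 1))
     + u 1 * u 2 / (1 + (1 - q) * u 1) ^ 2 * qStirling q r (j + 1)"

definition B_par :: "nat \<Rightarrow> 'a::field \<Rightarrow> (nat \<Rightarrow> 'a) \<Rightarrow> (nat \<Rightarrow> 'a) \<Rightarrow> nat \<Rightarrow> 'a" where
  "B_par r q a b j = q *
     (qpochs q (q # map a [1..<r+2]) j / qpochs q (map b [1..<r+2]) j) *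
     ((\<Prod>i=1..r+1. b i) / (q ^ r * (1 - q) * (\<Prod>i=1..r+1. a i))) ^ j"

end

(* Proof idea.  Put f_m(k) = q^((k-1)m)/[m]^k.  Then f_m(a+b) + (1-q) f_m(a+b-1) = f_m(a) f_m(b), so
   filling boxes by "+" or "-1+" amounts to letting neighbouring summation variables coincide, each
   coincidence weighted by t.  Hence the generating function is the sum over m >= 1 of
     G_m/(1 - t F_m) * prod_{n<m} (1 + (1-t) F_n)/(1 - t F_n),
   where F_m = sum_{k>=1} w(k) f_m(k), G_m is the same sum over k >= 2, and w(k) is the monomial
   that an entry k contributes.  As a function of X = [m], with q^m = 1 - (1-q) X, the series F_m
   has the denominator X^r (X - x_1); the parameters x_j are its partial fraction coefficients,
   and -alpha_i, -beta_i are the zeros of the numerators of 1 + (1-t) F_m and 1 - t F_m.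
   Up to normalization and the u_1 u_2 correction of the top degree, the c_i are the coefficients of
   the numerator of G_m divided by q^m; expanding it in q-falling factorials of [m-1] with q-Stirling
   numbers splits the sum into the r basic hypergeometric series. *)
theory Submission
  imports Defs
begin

section \<open>Formal power series\<close>

subsection \<open>Coefficients and order\<close>

text \<open>The parameters \<alpha>_i and \<beta>_i live only in a field without topology, so every
  infinite sum is formed in the series ring, where two filtrations are kept apart. The degree in t
  and the u_i controls the sum over indices: each entry has degree at least one and large entries
  have more, so a fixed monomial sees finitely many indices. The q-adic order controls the sum over
  the largest summation variable m: admissibility supplies a factor q^m. The hypergeometric series
  match this last sum term by term: term n of the j-th series belongs to m = j + n + 1. Two
  obstacles remain. The A_j contain negative powers of u_1, so a single product of A_j with its
  series need not visibly lie in the ring; the identity is multiplied by a power of u_1 before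
  limits are compared. And a_i, b_i are quotients in a field, so 1 + (1-q) \<alpha>_i and 1 + (1-q)
  \<beta>_i must be shown nonzero; their products are read off at X = 1/(1-q), the value of [m] when
  q^m is replaced by 0.\<close>

lemma mcoeff_zero [simp]: "mcoeff 0 M = 0"
  and mcoeff_one: "mcoeff 1 M = (if M = {#} then 1 else 0)"
  and mcoeff_add [simp]: "mcoeff (f + g) M = mcoeff f M + mcoeff g M"
  and mcoeff_diff [simp]: "mcoeff (f - g) M = mcoeff f M - mcoeff g M"
  by (simp_all add: mfps_defs)

lemma mcoeff_mult: "mcoeff (f * g) M = (\<Sum>(A, B)\<in>{(A, B). A + B = M}. mcoeff f A * mcoeff g B)"
  by (simp add: times_mfps_def)

lemma mcoeff_sum [simp]: "mcoeff (sum f A) M = (\<Sum>x\<in>A. mcoeff (f x) M)"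
  by (induction A rule: infinite_finite_induct) auto

lemma mcoeff_mconst: "mcoeff (mconst c) M = (if M = {#} then c else 0)"
  by (simp add: mconst_def)

lemma mcoeff_mconst_mult [simp]:
  fixes f :: "('v, 'a::comm_ring_1) mfps"
  shows "mcoeff (mconst c * f) M = c * mcoeff f M"
proof -
  have "mcoeff (mconst c * f) M =
      (\<Sum>(A, B)\<in>{({#}, M)}. mcoeff (mconst c :: ('v, 'a) mfps) A * mcoeff f B)"
    unfolding mcoeff_mult
    by (rule sum.mono_neutral_right) (auto simp: mcoeff_mconst split: if_splits)
  thus ?thesis by (simp add: mcoeff_mconst)
qed

lemma mconst_0 [simp]: "mconst 0 = 0"
  and mconst_1 [simp]: "mconst 1 = 1"
  and mconst_add: "mconst (c + d) = mconst c + mconst d"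
  and mconst_diff: "mconst (c - d) = mconst c - mconst d"
  by (rule mfps_eqI; simp add: mcoeff_mconst mcoeff_one)+

lemma mconst_mult: "mconst (c * d) = mconst c * mconst d"
  by (rule mfps_eqI) (simp add: mcoeff_mconst)

lemma mconst_power: "mconst (c ^ n) = mconst c ^ n"
  by (induction n) (simp_all add: mconst_mult)

lemma mconst_sum: "mconst (sum f A) = (\<Sum>x\<in>A. mconst (f x))"
  by (induction A rule: infinite_finite_induct) (simp_all add: mconst_add)

section \<open>Filtration by total degree (q has degree 0) and geometric series\<close>

definition order_ge :: "nat \<Rightarrow> ('v, 'a::comm_ring_1) mfps \<Rightarrow> bool" where
  "order_ge n f \<longleftrightarrow> (\<forall>M. size M < n \<longrightarrow> mcoeff f M = 0)"

lemma order_ge_0 [simp]: "order_ge 0 f"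
  and order_ge_zero [simp]: "order_ge n 0"
  by (simp_all add: order_ge_def)

lemma order_ge_mono: "order_ge n f \<Longrightarrow> m \<le> n \<Longrightarrow> order_ge m f"
  by (auto simp: order_ge_def)

lemma order_ge_add: "order_ge n f \<Longrightarrow> order_ge n g \<Longrightarrow> order_ge n (f + g)"
  and order_ge_diff: "order_ge n f \<Longrightarrow> order_ge n g \<Longrightarrow> order_ge n (f - g)"
  by (auto simp: order_ge_def)

lemma order_ge_sum: "(\<And>x. x \<in> A \<Longrightarrow> order_ge n (f x)) \<Longrightarrow> order_ge n (sum f A)"
  by (simp add: order_ge_def)

lemma order_ge_mult:
  assumes "order_ge m f" "order_ge n g"
  shows "order_ge (m + n) (f * g)"
  unfolding order_ge_def
proof safe
  fix M :: "'a multiset" assume M: "size M < m + n"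
  have "mcoeff f A * mcoeff g B = 0" if "A + B = M" for A B
  proof -
    have "size A < m \<or> size B < n" using that M by auto
    thus ?thesis using assms by (auto simp: order_ge_def)
  qed
  thus "mcoeff (f * g) M = 0"
    by (auto simp: mcoeff_mult intro!: sum.neutral)
qed

lemma order_ge_mult_left: "order_ge n g \<Longrightarrow> order_ge n (f * g)"
  using order_ge_mult[of 0 f n g] by simp

lemma order_ge_mult_right: "order_ge n g \<Longrightarrow> order_ge n (g * f)"
  using order_ge_mult_left[of n g f] by (simp add: mult.commute)

lemma order_ge_power: "order_ge m f \<Longrightarrow> order_ge (m * n) (f ^ n)"
proof (induction n)
  case (Suc n)
  thus ?case using order_ge_mult[of m f "m * n" "f ^ n"] by simp
qed auto

lemma order_ge_1_iff: "order_ge 1 f \<longleftrightarrow> mcoeff f {#} = 0"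
  by (auto simp: order_ge_def)

lemma order_ge_mvar [simp]: "order_ge 1 (mvar v)"
  unfolding order_ge_1_iff by (simp add: mvar_def)

text \<open>The geometric series of f. If f has no constant term, f^i has no monomials of size below
  i, so stopping at \<open>size M\<close> loses nothing.\<close>

definition mgeom :: "('v, 'a::comm_ring_1) mfps \<Rightarrow> ('v, 'a) mfps" where
  "mgeom f = Abs_mfps (\<lambda>M. \<Sum>i\<le>size M. mcoeff (f ^ i) M)"

lemma order_ge_mgeom_diff:
  assumes "order_ge 1 f"
  shows "order_ge (Suc d) (mgeom f - (\<Sum>i\<le>d. f ^ i))"
  unfolding order_ge_def
proof safe
  fix M :: "'a multiset" assume M: "size M < Suc d"
  have "(\<Sum>i\<le>d. mcoeff (f ^ i) M) = (\<Sum>i\<le>size M. mcoeff (f ^ i) M)"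
    using M order_ge_power[OF assms]
    by (intro sum.mono_neutral_right) (auto simp: order_ge_def)
  thus "mcoeff (mgeom f - (\<Sum>i\<le>d. f ^ i)) M = 0"
    by (simp add: mgeom_def)
qed

lemma mgeom:
  fixes f :: "('v, 'a::comm_ring_1) mfps"
  assumes "order_ge 1 f"
  shows "(1 - f) * mgeom f = 1"
proof (rule mfps_eqI)
  fix M :: "'v multiset"
  define d where "d = size M"
  have eq: "(1 - f) * (\<Sum>i\<le>d. f ^ i) = 1 - f ^ Suc d"
    using one_diff_power_eq[of f "Suc d"] by (simp add: lessThan_Suc_atMost)
  have "(1 - f) * mgeom f - 1 = (1 - f) * (mgeom f - (\<Sum>i\<le>d. f ^ i)) - f ^ Suc d"
    using eq by (simp add: algebra_simps)
  moreover have "order_ge (Suc d) ((1 - f) * (mgeom f - (\<Sum>i\<le>d. f ^ i)) - f ^ Suc d)"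
    using order_ge_power[OF assms, of "Suc d"]
    by (intro order_ge_diff order_ge_mult_left order_ge_mgeom_diff assms) simp
  ultimately have "order_ge (Suc d) ((1 - f) * mgeom f - 1)" by simp
  hence "mcoeff ((1 - f) * mgeom f - 1) M = 0"
    unfolding order_ge_def d_def by blast
  thus "mcoeff ((1 - f) * mgeom f) M = mcoeff 1 M" by simp
qed

subsection \<open>The \<open>q\<close>-adic topology\<close>

definition q_order_ge :: "nat \<Rightarrow> ('v, 'a::comm_ring_1 fps) mfps \<Rightarrow> bool" where
  "q_order_ge n f \<longleftrightarrow> (\<forall>M k. k < n \<longrightarrow> fps_nth (mcoeff f M) k = 0)"

lemma q_order_ge_zero [simp]: "q_order_ge n 0"
  by (simp add: q_order_ge_def)

lemma q_order_ge_mono: "q_order_ge n f \<Longrightarrow> m \<le> n \<Longrightarrow> q_order_ge m f"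
  by (auto simp: q_order_ge_def)

lemma q_order_ge_add: "q_order_ge n f \<Longrightarrow> q_order_ge n g \<Longrightarrow> q_order_ge n (f + g)"
  by (auto simp: q_order_ge_def)

lemma q_order_ge_sum: "(\<And>x. x \<in> A \<Longrightarrow> q_order_ge n (f x)) \<Longrightarrow> q_order_ge n (sum f A)"
  by (induction A rule: infinite_finite_induct) (auto intro: q_order_ge_add)

lemma q_order_ge_mult_left: "q_order_ge n g \<Longrightarrow> q_order_ge n (f * g)"
  by (auto simp: q_order_ge_def mcoeff_mult fps_sum_nth fps_mult_nth case_prod_beta intro!: sum.neutral)

lemma q_order_ge_X_power: "q_order_ge n (mconst fps_X ^ n * f)"
  by (simp add: q_order_ge_def mconst_power[symmetric] fps_X_power_mult_nth)

text \<open>Convergence modulo each q^n, uniformly in the monomial. It implies the coefficientwise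
  convergence of \<open>formal_sums\<close> and passes directly through multiplication by a fixed
  series.\<close>

definition q_sums :: "(nat \<Rightarrow> ('v, 'a::comm_ring_1 fps) mfps) \<Rightarrow> ('v, 'a fps) mfps \<Rightarrow> bool" where
  "q_sums g G \<longleftrightarrow> (\<forall>n. \<exists>N0. \<forall>N\<ge>N0. q_order_ge n (G - (\<Sum>i<N. g i)))"

lemma q_sums_imp_sums:
  assumes "q_sums g G"
  shows "(\<lambda>n. mcoeff (g n) M) sums mcoeff G M"
  unfolding sums_def tendsto_fps_iff
proof safe
  fix n
  obtain N0 where "\<forall>N\<ge>N0. q_order_ge (Suc n) (G - (\<Sum>i<N. g i))"
    using assms unfolding q_sums_def by blast
  thus "\<forall>\<^sub>F N in sequentially. fps_nth (\<Sum>i<N. mcoeff (g i) M) n = fps_nth (mcoeff G M) n"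
    unfolding eventually_sequentially by (intro exI[of _ N0]) (auto simp: q_order_ge_def)
qed

lemma q_sums_unique:
  assumes "q_sums g G" "q_sums g H" shows "G = H"
  by (rule mfps_eqI) (meson assms q_sums_imp_sums sums_unique2)

lemma q_sums_exists:
  assumes "\<And>n. q_order_ge n (g n)"
  shows "\<exists>G. q_sums g G"
proof
  \<comment> \<open>The coefficient of q^k receives nothing from terms with index above k, so a
    finite sum gives its limit.\<close>
  define G where "G = Abs_mfps (\<lambda>M. Abs_fps (\<lambda>k. \<Sum>i\<le>k. fps_nth (mcoeff (g i) M) k))"
  have "q_order_ge n (G - (\<Sum>i<N. g i))" if "n \<le> N" for n N
    unfolding q_order_ge_def
  proof safe
    fix M k assume k: "k < n"
    have "(\<Sum>i<N. fps_nth (mcoeff (g i) M) k) = (\<Sum>i\<le>k. fps_nth (mcoeff (g i) M) k)"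
      using k that assms by (intro sum.mono_neutral_right) (auto simp: q_order_ge_def)
    thus "fps_nth (mcoeff (G - (\<Sum>i<N. g i)) M) k = 0"
      by (simp add: G_def fps_sum_nth)
  qed
  thus "q_sums g G" unfolding q_sums_def by blast
qed

lemma q_sums_cmult:
  assumes "q_sums g G" shows "q_sums (\<lambda>n. c * g n) (c * G)"
  unfolding q_sums_def
proof
  fix n
  obtain N0 where "\<forall>N\<ge>N0. q_order_ge n (G - (\<Sum>i<N. g i))"
    using assms unfolding q_sums_def by blast
  thus "\<exists>N0. \<forall>N\<ge>N0. q_order_ge n (c * G - (\<Sum>i<N. c * g i))"
    by (intro exI[of _ N0])
       (auto simp: sum_distrib_left[symmetric] right_diff_distrib[symmetric] intro!: q_order_ge_mult_left)
qed

lemma q_sums_add: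
  assumes "q_sums g G" "q_sums h H" shows "q_sums (\<lambda>n. g n + h n) (G + H)"
  unfolding q_sums_def
proof
  fix n
  obtain N1 N2 where N: "\<forall>N\<ge>N1. q_order_ge n (G - (\<Sum>i<N. g i))"
      "\<forall>N\<ge>N2. q_order_ge n (H - (\<Sum>i<N. h i))"
    using assms unfolding q_sums_def by meson
  have "q_order_ge n (G + H - (\<Sum>i<N. g i + h i))" if "N \<ge> max N1 N2" for N
    using q_order_ge_add[of n "G - (\<Sum>i<N. g i)" "H - (\<Sum>i<N. h i)"] that N
    by (simp add: sum.distrib add_diff_add)
  thus "\<exists>N0. \<forall>N\<ge>N0. q_order_ge n (G + H - (\<Sum>i<N. g i + h i))" by blast
qed

lemma q_sums_sum:
  assumes "\<And>j. j \<in> A \<Longrightarrow> q_sums (g j) (G j)"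
  shows "q_sums (\<lambda>n. \<Sum>j\<in>A. g j n) (\<Sum>j\<in>A. G j)"
  using assms
proof (induction A rule: infinite_finite_induct)
  case (insert x F)
  thus ?case by (auto intro!: q_sums_add)
qed (simp_all add: q_sums_def)

text \<open>Needed because the j-th hypergeometric series first contributes to the summand m = j +
  1.\<close>

lemma q_sums_shift:
  assumes "q_sums g G" shows "q_sums (\<lambda>n. if j \<le> n then g (n - j) else 0) G"
proof -
  have *: "(\<Sum>i<N + j. if j \<le> i then g (i - j) else 0) = (\<Sum>i<N. g i)" for N
  proof -
    have "(\<Sum>i<N + j. if j \<le> i then g (i - j) else 0) = (\<Sum>i\<in>{j..<N + j}. g (i - j))"
      by (intro sum.mono_neutral_cong_right) auto
    also have "\<dots> = (\<Sum>i<N. g i)"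
      by (rule sum.reindex_bij_witness[of _ "\<lambda>i. i + j" "\<lambda>i. i - j"]) auto
    finally show ?thesis .
  qed
  show ?thesis unfolding q_sums_def
  proof
    fix n
    obtain N0 where N0: "\<forall>N\<ge>N0. q_order_ge n (G - (\<Sum>i<N. g i))"
      using assms unfolding q_sums_def by blast
    have "q_order_ge n (G - (\<Sum>i<N. if j \<le> i then g (i - j) else 0))" if "N \<ge> N0 + j" for N
      using *[of "N - j"] N0 that by simp
    thus "\<exists>N0. \<forall>N\<ge>N0. q_order_ge n (G - (\<Sum>i<N. if j \<le> i then g (i - j) else 0))" by blast
  qed
qed

lemma formal_sumsI:
  assumes "q_sums g G" "\<And>n. f n = \<iota> (g n)"
  shows "formal_sums \<iota> f (\<iota> G)"
  unfolding formal_sums_def using assms q_sums_imp_sums by blast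

text \<open>Injectivity determines the ring elements behind the terms, and coefficientwise limits
  are unique; so the description by \<open>THE\<close> has exactly one candidate.\<close>

lemma formal_suminf_eqI:
  assumes "inj \<iota>" "q_sums g G" "\<And>n. f n = \<iota> (g n)"
  shows "formal_suminf \<iota> f = \<iota> G"
  unfolding formal_suminf_def
proof (rule the_equality)
  show "formal_sums \<iota> f (\<iota> G)" using assms by (intro formal_sumsI)
next
  fix s assume "formal_sums \<iota> f s"
  then obtain h H where h: "\<And>n. f n = \<iota> (h n)" "s = \<iota> H"
      "\<And>M. (\<lambda>n. mcoeff (h n) M) sums mcoeff H M"
    unfolding formal_sums_def by blast
  have "h = g" using h(1) assms(1,3) by (auto simp: inj_def)
  hence "H = G" by (intro mfps_eqI) (use h(3) q_sums_imp_sums[OF assms(2)] sums_unique2 in blast)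
  thus "s = \<iota> G" using h by simp
qed

section \<open>Generating function of interpolated values\<close>

subsection \<open>Truncated multiple zeta values\<close>

lemma qint_fps_X_mult: "(1 - fps_X) * qint fps_X n = (1 - fps_X ^ n :: rat fps)"
  by (simp add: qint_def fps_divide_unit mult.assoc mult.left_commute[of _ _ "inverse _"]
      inverse_mult_eq_1')

lemma qint_fps_X_nth_0: "n \<ge> 1 \<Longrightarrow> fps_nth (qint fps_X n :: rat fps) 0 = 1"
  by (simp add: qint_def fps_divide_unit)

definition zfac :: "nat \<Rightarrow> nat \<Rightarrow> rat fps" where
  "zfac m k = fps_X ^ ((k - 1) * m) / qint fps_X m ^ k"

lemma zfac_eq: "m \<ge> 1 \<Longrightarrow> zfac m k = fps_X ^ ((k - 1) * m) * inverse (qint fps_X m) ^ k"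
  by (simp add: zfac_def fps_divide_unit fps_power_zeroth qint_fps_X_nth_0 fps_inverse_power)

text \<open>With X = q^m and I = 1/[m] one has 1 - q = (1 - X) I. The second summand is therefore
  (X^(a+b-2) - X^(a+b-1)) I^(a+b), and its negative part cancels the first summand.\<close>

lemma zfac_merge:
  assumes "m \<ge> 1" "a \<ge> 1" "b \<ge> 1"
  shows "zfac m (a + b) + (1 - fps_X) * zfac m (a + b - 1) = zfac m a * zfac m b"
proof -
  obtain a' b' where ab: "a = Suc a'" "b = Suc b'"
    using assms by (metis Suc_le_D One_nat_def)
  define X where "X = (fps_X :: rat fps) ^ m"
  define J where "J = (qint fps_X m :: rat fps)"
  define I where "I = inverse J"
  have JI: "J * I = 1" unfolding I_def J_def using qint_fps_X_nth_0[OF assms(1)]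
    by (intro inverse_mult_eq_1') auto
  have sJ: "(1 - fps_X) * J = 1 - X"
    unfolding X_def J_def by (rule qint_fps_X_mult)
  have sI: "(1 - fps_X) = (1 - X) * I"
    using sJ JI by (metis mult.assoc mult.right_neutral)
  have z: "zfac m (Suc n) = X ^ n * I ^ Suc n" for n
    unfolding X_def I_def J_def using assms(1)
    by (simp only: zfac_eq diff_Suc_1 power_mult[symmetric] mult.commute[of n m])
  have e: "a + b = Suc (Suc (a' + b'))" "a + b - 1 = Suc (a' + b')"
    by (simp_all add: ab)
  show ?thesis
    unfolding e(2) unfolding e(1) unfolding ab z sI by (simp add: power_add algebra_simps)
qed

text \<open>The multiple sum restricted to m_1 \<le> N. It makes sense for inadmissible indices too,
  which occur as tails in the recursion.\<close>

primrec zeta_trunc :: "nat list \<Rightarrow> nat \<Rightarrow> rat fps" where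
  "zeta_trunc [] N = 1"
| "zeta_trunc (k # ks) N = (\<Sum>m=1..N. zfac m k * zeta_trunc ks (m - 1))"

definition mz_indices :: "nat \<Rightarrow> nat \<Rightarrow> nat list set" where
  "mz_indices l N = {ms. length ms = l \<and> sorted_wrt (>) ms \<and> (\<forall>m\<in>set ms. 1 \<le> m \<and> m \<le> N)}"

lemma mz_indices_Suc:
  "mz_indices (Suc l) N = (\<lambda>(m, ms). m # ms) ` (SIGMA m:{1..N}. mz_indices l (m - 1))"
proof (intro equalityI subsetI)
  fix ms assume "ms \<in> mz_indices (Suc l) N"
  then obtain m ms' where ms: "ms = m # ms'" and *: "m # ms' \<in> mz_indices (Suc l) N"
    by (cases ms) (auto simp: mz_indices_def)
  hence "(m, ms') \<in> (SIGMA m:{1..N}. mz_indices l (m - 1))"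
    by (fastforce simp: mz_indices_def)
  thus "ms \<in> (\<lambda>(m, ms). m # ms) ` (SIGMA m:{1..N}. mz_indices l (m - 1))"
    unfolding ms by force
qed (force simp: mz_indices_def)

lemma finite_mz_indices: "finite (mz_indices l N)"
  by (rule finite_subset[OF _ finite_lists_length_eq[of "{..N}" l]]) (auto simp: mz_indices_def)

lemma zeta_trunc_eq_sum:
  "zeta_trunc ks N = (\<Sum>ms\<in>mz_indices (length ks) N. \<Prod>j<length ks. zfac (ms ! j) (ks ! j))"
proof (induction ks arbitrary: N)
  case Nil
  have "mz_indices 0 N = {[]}" by (auto simp: mz_indices_def)
  thus ?case by simp
next
  case (Cons k ks)
  have "(\<Sum>ms\<in>mz_indices (length (k # ks)) N. \<Prod>j<length (k # ks). zfac (ms ! j) ((k # ks) ! j)) =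
      (\<Sum>(m, ms)\<in>(SIGMA m:{1..N}. mz_indices (length ks) (m - 1)).
         zfac m k * (\<Prod>j<length ks. zfac (ms ! j) (ks ! j)))"
    unfolding length_Cons mz_indices_Suc
    by (subst sum.reindex) (auto simp: inj_on_def prod.lessThan_Suc_shift
        simp del: prod.lessThan_Suc intro!: sum.cong)
  also have "\<dots> = zeta_trunc (k # ks) N"
    by (subst sum.Sigma[symmetric]) (auto simp: finite_mz_indices Cons.IH sum_distrib_left)
  finally show ?case ..
qed

text \<open>Since k_1 \<ge> 2, a term with leading variable m_1 is divisible by q^(m_1). Terms with
  m_1 > n thus do not reach the coefficient of q^n, which is stable from truncation n on; the limit
  is the diagonal series \<open>L\<close>.\<close>

lemma zeta_q_nth:
  assumes "admissible ks" "n \<le> N"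
  shows "fps_nth (zeta_q ks) n = fps_nth (zeta_trunc ks N) n"
proof -
  define S where "S = {ms. length ms = length ks \<and> sorted_wrt (>) ms \<and> (\<forall>m\<in>set ms. m \<ge> (1::nat))}"
  define f where "f ms = (\<Prod>j<length ks. zfac (ms ! j) (ks ! j))" for ms
  obtain k ks' where ks: "ks = k # ks'" "k \<ge> 2"
    using assms(1) by (cases ks) (auto simp: admissible_def)
  have sub: "mz_indices (length ks) M \<subseteq> S" for M by (auto simp: S_def mz_indices_def)
  have zero: "fps_nth (f ms) n = 0" if ms: "ms \<in> S" "ms \<notin> mz_indices (length ks) M" "n \<le> M" for ms n M
  proof -
    obtain m ms' where m: "ms = m # ms'"
      using ms ks by (cases ms) (auto simp: S_def)
    have "m > M" using ms unfolding m S_def mz_indices_def by fastforce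
    hence "m \<ge> 1" by simp
    have "1 * m \<le> (k - 1) * m" using ks(2) by (intro mult_right_mono) auto
    hence "n < (k - 1) * m" using \<open>m > M\<close> ms(3) by linarith
    moreover have "f ms = fps_X ^ ((k - 1) * m) * (inverse (qint fps_X m) ^ k *
        (\<Prod>j<length ks'. zfac (ms' ! j) (ks' ! j)))"
      using \<open>m \<ge> 1\<close> by (simp add: f_def ks m prod.lessThan_Suc_shift zfac_eq mult.assoc del: prod.lessThan_Suc)
    ultimately show ?thesis by (simp add: fps_X_power_mult_nth)
  qed
  have agree: "fps_nth (sum f Y) n = fps_nth (zeta_trunc ks M) n"
    if "finite Y" "Y \<subseteq> S" "mz_indices (length ks) M \<subseteq> Y" "n \<le> M" for Y n M
    unfolding zeta_trunc_eq_sum f_def[symmetric] fps_sum_nth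
    by (rule sum.mono_neutral_right) (use that zero in auto)
  define L where "L = Abs_fps (\<lambda>n. fps_nth (zeta_trunc ks n) n)"
  have "(f has_sum L) S"
    unfolding has_sum_def tendsto_fps_iff
  proof
    fix n
    show "\<forall>\<^sub>F Y in finite_subsets_at_top S. fps_nth (sum f Y) n = fps_nth L n"
      unfolding eventually_finite_subsets_at_top
      using agree[of _ n n] sub[of n] finite_mz_indices[of "length ks" n]
      by (intro exI[of _ "mz_indices (length ks) n"]) (auto simp: L_def)
  qed
  moreover have "zeta_q ks = infsum f S"
    unfolding zeta_q_def S_def f_def zfac_def ..
  ultimately have "zeta_q ks = L" using infsumI by blast
  moreover have "mz_indices (length ks) n \<subseteq> mz_indices (length ks) N"
    using assms(2) by (auto simp: mz_indices_def)
  hence "fps_nth (zeta_trunc ks n) n = fps_nth (zeta_trunc ks N) n"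
    using agree[OF finite_mz_indices sub, of n N n] agree[OF finite_mz_indices sub order_refl assms(2)]
    by simp
  ultimately show ?thesis by (simp add: L_def)
qed

subsection \<open>Interpolation\<close>

text \<open>The difference isolates the part of the tail whose leading variable is exactly m.
  Unfolded, this is a sum over weakly decreasing variables bounded by N, with one factor t for each
  equality of neighbours.\<close>

primrec zeta_t_trunc :: "nat list \<Rightarrow> nat \<Rightarrow> pseries" where
  "zeta_t_trunc [] N = 1"
| "zeta_t_trunc (k # ks) N = (\<Sum>m=1..N. mconst (zfac m k) *
     (zeta_t_trunc ks (m - 1) + t_ser * (zeta_t_trunc ks m - zeta_t_trunc ks (m - 1))))"

text \<open>\<open>zeta_qt\<close> with an arbitrary function in place of \<open>zeta_q\<close>.
  This allows truncated values, and it allows a leading entry followed by a comma to be absorbed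
  into Z.\<close>

definition zeta_fill :: "(nat list \<Rightarrow> rat fps) \<Rightarrow> nat list \<Rightarrow> pseries" where
  "zeta_fill Z ks = (\<Sum>bs\<in>{bs. length bs = length ks - 1}.
     let p = fill ks bs in
       mconst ((1 - fps_X) ^ (sum_list ks - sum_list p) * Z p) * t_ser ^ (length ks - length p))"

lemma UNIV_box: "UNIV = {Comma, Plus, MinusOnePlus}"
  by (auto intro: box.exhaust)

lemma sum_box_lists:
  fixes g :: "box list \<Rightarrow> 'a::comm_monoid_add"
  shows "(\<Sum>bs | length bs = Suc n. g bs) =
     (\<Sum>bs | length bs = n. g (Comma # bs)) + (\<Sum>bs | length bs = n. g (Plus # bs)) +
     (\<Sum>bs | length bs = n. g (MinusOnePlus # bs))"
proof -
  have "(\<Sum>bs | length bs = Suc n. g bs) = (\<Sum>(b, bs)\<in>UNIV \<times> {bs. length bs = n}. g (b # bs))"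
    by (rule sum.reindex_bij_witness[of _ "\<lambda>(b, bs). b # bs" "\<lambda>bs. (hd bs, tl bs)"])
       (auto simp: length_Suc_conv)
  also have "\<dots> = (\<Sum>b\<in>UNIV. \<Sum>bs | length bs = n. g (b # bs))"
    by (rule sum.cartesian_product[symmetric])
  finally show ?thesis by (simp add: UNIV_box add.assoc)
qed

text \<open>The bounds on sum and length make the truncated subtractions in the exponents honest;
  the bound on the head keeps every filling of an admissible index admissible.\<close>

lemma fill_bounds:
  assumes "\<forall>k\<in>set ks. k \<ge> 1" "ks \<noteq> []"
  shows "fill ks bs \<noteq> [] \<and> (\<forall>k\<in>set (fill ks bs). k \<ge> 1) \<and> sum_list (fill ks bs) \<le> sum_list ks \<and>
    length (fill ks bs) \<le> length ks \<and> hd ks \<le> hd (fill ks bs)"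
  using assms by (induction ks bs rule: fill.induct) fastforce+

lemma zeta_fill_singleton: "zeta_fill Z [k] = mconst (Z [k])"
  by (simp add: zeta_fill_def)

text \<open>Case distinction on the first box. Either merge lowers the length by one and costs a t;
  "-1+" also lowers the weight by one and costs a factor 1 - q.\<close>

lemma zeta_fill_Cons:
  assumes "\<forall>k\<in>set ks. k \<ge> 1" "a \<ge> 1" "b \<ge> 1"
  shows "zeta_fill Z (a # b # ks) = zeta_fill (\<lambda>p. Z (a # p)) (b # ks) +
    t_ser * (zeta_fill Z ((a + b) # ks) + mconst (1 - fps_X) * zeta_fill Z ((a + b - 1) # ks))"
proof -
  define h where "h Z ks bs = (let p = fill ks bs in
       mconst ((1 - fps_X) ^ (sum_list ks - sum_list p) * Z p) * t_ser ^ (length ks - length p))"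
    for Z :: "nat list \<Rightarrow> rat fps" and ks bs
  have zf: "zeta_fill Z ks = (\<Sum>bs | length bs = length ks - 1. h Z ks bs)" for Z ks
    by (simp add: zeta_fill_def h_def)
  have 1: "h Z (a # b # ks) (Comma # bs) = h (\<lambda>p. Z (a # p)) (b # ks) bs" for bs
    using fill_bounds[of "b # ks" bs] assms by (simp add: h_def Let_def Suc_diff_le)
  have 2: "h Z (a # b # ks) (Plus # bs) = t_ser * h Z ((a + b) # ks) bs" for bs
    using fill_bounds[of "(a + b) # ks" bs] assms
    by (simp add: h_def Let_def Suc_diff_le mult_ac add.assoc)
  have 3: "h Z (a # b # ks) (MinusOnePlus # bs) =
      t_ser * (mconst (1 - fps_X) * h Z ((a + b - 1) # ks) bs)" for bs
  proof -
    define c where "c = a + b - 1"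
    have ab: "a + b = Suc c" and c: "c \<ge> 1" using assms by (auto simp: c_def)
    have f: "fill (a # b # ks) (MinusOnePlus # bs) = fill (c # ks) bs" by (simp add: c_def)
    have *: "sum_list (fill (c # ks) bs) \<le> c + sum_list ks"
        "length (fill (c # ks) bs) \<le> Suc (length ks)"
      using fill_bounds[of "c # ks" bs] assms(1) c by auto
    have s: "sum_list (a # b # ks) = Suc (sum_list (c # ks))" using ab by simp
    show ?thesis using * unfolding h_def Let_def f s c_def[symmetric]
      by (simp add: Suc_diff_le mconst_mult mult_ac)
  qed
  show ?thesis
    unfolding zf by (simp add: sum_box_lists 1 2 3 sum_distrib_left distrib_left add.assoc)
qed

lemma zeta_fill_sum:
  "zeta_fill (\<lambda>p. \<Sum>m\<in>A. c m * Z m p) ks = (\<Sum>m\<in>A. mconst (c m) * zeta_fill (Z m) ks)"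
  unfolding zeta_fill_def Let_def sum_distrib_left
  by (subst sum.swap) (simp add: sum_distrib_left sum_distrib_right mconst_sum mconst_mult mult_ac)

text \<open>The induction is on the length because the merged lists are not sublists. By
  \<open>zfac_merge\<close> the two merged sums combine to f_m(a) f_m(b) times the same tail
  \<open>Y m\<close>, and f_m(b) times \<open>Y m\<close> is the increment of the value of
  \<open>b # cs\<close> at m, which is the t-part of the recursion.\<close>

lemma zeta_fill_trunc:
  assumes "\<forall>k\<in>set ks. k \<ge> 1" "ks \<noteq> []"
  shows "zeta_fill (\<lambda>p. zeta_trunc p N) ks = zeta_t_trunc ks N"
  using assms
proof (induction ks arbitrary: N rule: length_induct)
  case (1 ks)
  show ?case
  proof (cases "\<exists>a. ks = [a]")
    case True
    thus ?thesis by (auto simp: zeta_fill_singleton mconst_sum)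
  next
    case False
    then obtain a b cs where ks: "ks = a # b # cs"
      using 1(3) by (metis list.exhaust)
    have ge: "\<forall>k\<in>set cs. k \<ge> 1" "a \<ge> 1" "b \<ge> 1" using 1(2) ks by auto
    have IH1: "zeta_fill (\<lambda>p. zeta_trunc p N) (b # cs) = zeta_t_trunc (b # cs) N" for N
      using 1(1) ge unfolding ks by (auto simp del: zeta_t_trunc.simps zeta_trunc.simps)
    have IH2: "zeta_fill (\<lambda>p. zeta_trunc p N) ((a + b) # cs) = zeta_t_trunc ((a + b) # cs) N"
      using 1(1) ge unfolding ks by (auto simp del: zeta_t_trunc.simps zeta_trunc.simps)
    have IH3: "zeta_fill (\<lambda>p. zeta_trunc p N) ((a + b - 1) # cs) = zeta_t_trunc ((a + b - 1) # cs) N"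
      using 1(1) ge unfolding ks by (auto simp del: zeta_t_trunc.simps zeta_trunc.simps)
    define Y where "Y m = zeta_t_trunc cs (m - 1) + t_ser * (zeta_t_trunc cs m - zeta_t_trunc cs (m - 1))" for m
    have step: "zeta_t_trunc (b # cs) m - zeta_t_trunc (b # cs) (m - 1) = mconst (zfac m b) * Y m"
      if "m \<ge> 1" for m
      using that by (cases m) (simp_all add: Y_def)
    have "zeta_t_trunc ((a + b) # cs) N + mconst (1 - fps_X) * zeta_t_trunc ((a + b - 1) # cs) N =
        (\<Sum>m=1..N. mconst (zfac m (a + b) + (1 - fps_X) * zfac m (a + b - 1)) * Y m)"
      unfolding zeta_t_trunc.simps Y_def[symmetric] sum_distrib_left sum.distrib[symmetric]
      by (simp only: mconst_add mconst_mult distrib_right mult.assoc)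
    also have "\<dots> = (\<Sum>m=1..N. mconst (zfac m a) * (mconst (zfac m b) * Y m))"
      using ge by (intro sum.cong refl, subst zfac_merge) (auto simp: mconst_mult mult_ac)
    also have "\<dots> = (\<Sum>m=1..N. mconst (zfac m a) *
        (zeta_t_trunc (b # cs) m - zeta_t_trunc (b # cs) (m - 1)))"
      by (intro sum.cong refl, subst step) auto
    finally have merge: "zeta_t_trunc ((a + b) # cs) N +
        mconst (1 - fps_X) * zeta_t_trunc ((a + b - 1) # cs) N = \<dots>" .
    have "zeta_fill (\<lambda>p. zeta_trunc p N) ks =
        zeta_fill (\<lambda>p. zeta_trunc (a # p) N) (b # cs) + t_ser *
         (zeta_t_trunc ((a + b) # cs) N + mconst (1 - fps_X) * zeta_t_trunc ((a + b - 1) # cs) N)"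
      unfolding ks by (simp only: zeta_fill_Cons[OF ge] IH2 IH3)
    also have "\<dots> = zeta_t_trunc ks N"
      unfolding merge ks zeta_trunc.simps zeta_fill_sum IH1 zeta_t_trunc.simps(2)[of a]
      by (simp add: distrib_left sum.distrib sum_distrib_left mult_ac del: zeta_t_trunc.simps)
    finally show ?thesis .
  qed
qed

lemma zeta_qt_approx:
  assumes "admissible ks"
  shows "q_order_ge (Suc N) (zeta_qt ks - zeta_t_trunc ks N)"
proof -
  have adm: "admissible (fill ks bs)" for bs
    using fill_bounds[of ks bs] assms by (auto simp: admissible_def)
  have *: "\<forall>k\<in>set ks. k \<ge> 1" "ks \<noteq> []"
    using assms by (auto simp: admissible_def)
  have "zeta_qt ks - zeta_t_trunc ks N = (\<Sum>bs | length bs = length ks - 1.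
      t_ser ^ (length ks - length (fill ks bs)) * mconst ((1 - fps_X) ^ (sum_list ks - sum_list (fill ks bs)))
       * mconst (zeta_q (fill ks bs) - zeta_trunc (fill ks bs) N))"
    unfolding zeta_fill_trunc[OF *, symmetric] zeta_qt_def zeta_fill_def Let_def sum_subtractf[symmetric]
    by (intro sum.cong refl) (simp add: mconst_diff mconst_mult algebra_simps)
  moreover have "q_order_ge (Suc N) (mconst (zeta_q (fill ks bs) - zeta_trunc (fill ks bs) N) :: pseries)" for bs
    using zeta_q_nth[OF adm] by (simp add: q_order_ge_def mcoeff_mconst)
  ultimately show ?thesis
    by (auto intro!: q_order_ge_sum q_order_ge_mult_left)
qed

subsection \<open>The generating function as a sum over indices\<close>

definition wt_entry :: "nat \<Rightarrow> nat \<Rightarrow> pseries" where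
  "wt_entry r k = (if k \<le> r then u_ser (k + 1) else u_ser (r + 2) * u_ser 1 ^ (k - r - 1))"

definition wt :: "nat \<Rightarrow> nat list \<Rightarrow> pseries" where
  "wt r ks = (\<Prod>k\<leftarrow>ks. wt_entry r k)"

lemma wt_simps [simp]: "wt r [] = 1" "wt r (k # ks) = wt_entry r k * wt r ks"
  by (simp_all add: wt_def)

lemma order_ge_wt_entry: "order_ge (max 1 (k - r)) (wt_entry r k)"
proof (cases "k \<le> r")
  case True
  thus ?thesis by (simp add: wt_entry_def del: One_nat_def)
next
  case False
  hence "max 1 (k - r) = 1 + 1 * (k - r - 1)" by simp
  thus ?thesis using False order_ge_mult[OF order_ge_mvar order_ge_power[OF order_ge_mvar]]
    by (simp only: wt_entry_def if_False)
qed

lemma order_ge_wt: "order_ge (\<Sum>k\<leftarrow>ks. max 1 (k - r)) (wt r ks)"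
  by (induction ks) (auto intro: order_ge_mult order_ge_wt_entry simp del: One_nat_def)

lemma order_ge_wt_length: "order_ge (length ks) (wt r ks)"
proof (rule order_ge_mono[OF order_ge_wt])
  show "length ks \<le> (\<Sum>k\<leftarrow>ks. max 1 (k - r))" by (induction ks) auto
qed

text \<open>An entry k has degree at least max 1 (k - r), and k \<le> (r + 1) max 1 (k - r). So the
  weight bounds the degree from below, and only finitely many indices reach a given
  monomial.\<close>

lemma mcoeff_wt_eq_0:
  assumes "(r + 1) * size M < sum_list ks"
  shows "mcoeff (f * wt r ks) M = 0"
proof -
  have "sum_list ks \<le> (r + 1) * (\<Sum>k\<leftarrow>ks. max 1 (k - r))"
  proof (induction ks)
    case (Cons k ks)
    have "k \<le> (r + 1) * max 1 (k - r)"
    proof (cases "k \<le> r")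
      case False
      then obtain d where "k = r + Suc d" by (metis add_Suc_right less_imp_Suc_add not_le)
      thus ?thesis by simp
    qed auto
    with Cons show ?case by (simp add: distrib_left del: mult_Suc)
  qed simp
  hence "(r + 1) * size M < (r + 1) * (\<Sum>k\<leftarrow>ks. max 1 (k - r))" using assms by linarith
  hence "size M < (\<Sum>k\<leftarrow>ks. max 1 (k - r))" by (simp only: mult_less_cancel1)
  moreover have "order_ge (\<Sum>k\<leftarrow>ks. max 1 (k - r)) (f * wt r ks)"
    by (intro order_ge_mult_left order_ge_wt)
  ultimately show ?thesis unfolding order_ge_def by blast
qed

lemma height_eq: "height i ks = length (filter (\<lambda>k. k \<ge> i + 1) ks)"
  by (simp add: height_def length_filter_conv_card)

lemma height_Nil [simp]: "height i [] = 0"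
  and height_Cons: "height i (k # ks) = (if k \<ge> i + 1 then 1 else 0) + height i ks"
  by (simp_all add: height_eq)

lemma height_step: "height i ks = height (Suc i) ks + count_list ks (Suc i)"
  by (induction ks) (auto simp: height_Cons)

lemma length_eq_height_1:
  "\<forall>k\<in>set ks. k \<ge> 1 \<Longrightarrow> length ks = height 1 ks + count_list ks 1"
  by (induction ks) (auto simp: height_Cons)

text \<open>Split each entry as k = 1 + min r (k - 1) + (k - r - 1) in truncated subtraction; the
  middle part counts the i \<le> r with k \<ge> i + 1. This identifies the exponent of u_1. The case
  r = 0 also bounds the depth by the weight.\<close>

lemma sum_list_eq_heights:
  "\<forall>k\<in>set ks. k \<ge> 1 \<Longrightarrow>
     sum_list ks = length ks + (\<Sum>j=1..r. height j ks) + (\<Sum>k\<leftarrow>ks. k - r - 1)"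
proof (induction ks)
  case (Cons k ks)
  have "(\<Sum>j=1..r. if j + 1 \<le> k then 1 else 0) = card {j\<in>{1..r}. j + 1 \<le> k}"
    by (simp add: sum.If_cases Int_def)
  also have "{j\<in>{1..r}. j + 1 \<le> k} = {1..min r (k - 1)}" by auto
  finally have "(\<Sum>j=1..r. if j + 1 \<le> k then 1 else 0) = min r (k - 1)" by simp
  moreover have "k = 1 + min r (k - 1) + (k - r - 1)" using Cons.prems by auto
  ultimately show ?case using Cons
    by (simp add: height_Cons sum.distrib)
qed simp

lemma wt_eq_prod:
  assumes "\<forall>k\<in>set ks. k \<ge> 1"
  shows "wt r ks = u_ser 1 ^ (\<Sum>k\<leftarrow>ks. k - r - 1) * (\<Prod>i=1..r. u_ser (i + 1) ^ count_list ks i) *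
    u_ser (r + 2) ^ height r ks"
  using assms
proof (induction ks)
  case (Cons k ks)
  have *: "(\<Prod>i=1..r. u_ser (i + 1) ^ count_list (k # ks) i) =
      (if k \<le> r then u_ser (k + 1) else 1) * (\<Prod>i=1..r. u_ser (i + 1) ^ count_list ks i)"
  proof -
    have "(\<Prod>i=1..r. u_ser (i + 1) ^ count_list (k # ks) i) =
        (\<Prod>i=1..r. (if i = k then u_ser (k + 1) else 1) * u_ser (i + 1) ^ count_list ks i)"
      by (intro prod.cong) auto
    thus ?thesis using Cons.prems by (simp add: prod.distrib)
  qed
  show ?case unfolding * using Cons
    by (auto simp: wt_entry_def height_Cons power_add mult_ac)
qed simp

text \<open>Differences of consecutive heights count the entries equal to a given number. So the
  exponents of the u_i are additive over the entries, and the monomial factors entry by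
  entry.\<close>

lemma u_monomial_eq_wt:
  assumes "\<forall>k\<in>set ks. k \<ge> 1" "r \<ge> 1" "length hs = r" "\<forall>i\<in>{1..r}. height i ks = hs ! (i - 1)"
  shows "u_monomial r (sum_list ks) (length ks) hs = wt r ks"
proof -
  have h: "hs ! i = height (Suc i) ks" if "i < r" for i
    using assms(4) that by auto
  have 1: "sum_list ks - length ks - (\<Sum>j=1..r. hs ! (j - 1)) = (\<Sum>k\<leftarrow>ks. k - r - 1)"
    using sum_list_eq_heights[OF assms(1), of r] assms(4) by simp
  have 2: "length ks - hs ! 0 = count_list ks 1"
    using length_eq_height_1[OF assms(1)] h[of 0] assms(2) by simp
  have 3: "hs ! (i - 1) - hs ! i = count_list ks (i + 1)" if "i \<in> {1..<r}" for i
  proof -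
    have "hs ! (i - 1) = height i ks" using assms(4) that by auto
    thus ?thesis using that h[of i] height_step[of i ks] by simp
  qed
  have "(\<Prod>i=1..r. u_ser (i + 1) ^ count_list ks i) =
      u_ser 2 ^ count_list ks 1 * (\<Prod>i=1..<r. u_ser (i + 2) ^ count_list ks (i + 1))"
  proof -
    have "(\<Prod>i=1..r. u_ser (i + 1) ^ count_list ks i) =
        u_ser 2 ^ count_list ks 1 * (\<Prod>i=2..r. u_ser (i + 1) ^ count_list ks i)"
      using assms(2) by (subst prod.atLeast_Suc_atMost) (auto simp: numeral_2_eq_2)
    also have "(\<Prod>i=2..r. u_ser (i + 1) ^ count_list ks i) =
        (\<Prod>i=1..<r. u_ser (i + 2) ^ count_list ks (i + 1))"
      by (rule prod.reindex_bij_witness[of _ "\<lambda>i. i + 1" "\<lambda>i. i - 1"]) auto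
    finally show ?thesis .
  qed
  moreover have "(\<Prod>i=1..<r. u_ser (i + 2) ^ (hs ! (i - 1) - hs ! i)) =
      (\<Prod>i=1..<r. u_ser (i + 2) ^ count_list ks (i + 1))"
    by (intro prod.cong refl) (simp only: 3)
  ultimately show ?thesis
    using h[of "r - 1"] assms(2)
    by (simp add: u_monomial_def wt_eq_prod[OF assms(1)] 1[simplified] 2[simplified] mult_ac)
qed

lemma finite_bounded_indices: "finite {ks. (\<forall>k\<in>set ks. k \<ge> 1) \<and> sum_list ks \<le> (B::nat)}"
proof (rule finite_subset[OF _ finite_lists_length_le[of "{..B}" B]])
  show "{ks. (\<forall>k\<in>set ks. k \<ge> 1) \<and> sum_list ks \<le> B} \<subseteq> {ks. set ks \<subseteq> {..B} \<and> length ks \<le> B}"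
  proof safe
    fix ks x assume ks: "\<forall>k\<in>set ks. k \<ge> 1" "sum_list ks \<le> B"
    show "length ks \<le> B"
      using ks sum_list_eq_heights[of ks 0] by simp
    assume "x \<in> set ks"
    thus "x \<le> B" using member_le_sum_list[of x ks] ks(2) by simp
  qed
qed simp

text \<open>Indices are grouped by weight, depth and heights; all but finitely many groups
  contribute zero to M. The finite set S is left free so that it can later be a box, which suits
  recursion on the first entry better than a bound on the weight.\<close>

lemma mcoeff_Psi0:
  assumes "r \<ge> 1" "finite S" "S \<subseteq> Collect admissible"
    and "{ks. admissible ks \<and> sum_list ks \<le> (r + 1) * size M} \<subseteq> S"
  shows "mcoeff (Psi0 r) M = (\<Sum>ks\<in>S. mcoeff (zeta_qt ks * wt r ks) M)"
proof -
  define B where "B = (r + 1) * size M"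
  define c where "c ks = mcoeff (zeta_qt ks * wt r ks) M" for ks
  define key where "key ks = (sum_list ks, length ks, map (\<lambda>i. height i ks) [1..<r + 1])" for ks
  define P where "P = {ks. admissible ks \<and> sum_list ks \<le> B}"
  have finP: "finite P"
    by (rule finite_subset[OF _ finite_bounded_indices[of B]]) (auto simp: P_def admissible_def)
  have key_iff: "key ks = (k, l, hs) \<longleftrightarrow>
      sum_list ks = k \<and> length ks = l \<and> (\<forall>i\<in>{1..length hs}. height i ks = hs ! (i - 1))"
    if "length hs = r" for ks k l hs
  proof -
    have "map (\<lambda>i. height i ks) [1..<r + 1] = hs \<longleftrightarrow> (\<forall>i\<in>{1..length hs}. height i ks = hs ! (i - 1))"
    proof -
      have "map (\<lambda>i. height i ks) [1..<r + 1] = hs \<longleftrightarrow> (\<forall>i<r. height (Suc i) ks = hs ! i)"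
        using that by (auto simp: list_eq_iff_nth_eq simp del: upt_Suc)
      also have "\<dots> \<longleftrightarrow> (\<forall>i\<in>{1..r}. height i ks = hs ! (i - 1))"
        by (metis One_nat_def Suc_le_eq Suc_pred' atLeastAtMost_iff diff_Suc_1 less_eq_Suc_le zero_less_Suc)
      finally show ?thesis using that by simp
    qed
    thus ?thesis by (auto simp: key_def)
  qed
  define F where "F = (\<lambda>(k, l, hs). mcoeff (xi0 k l hs * u_monomial r k l hs) M)"
  have F: "F p = (\<Sum>ks | admissible ks \<and> key ks = p. c ks)" if "length (snd (snd p)) = r" for p
  proof -
    obtain k l hs where p: "p = (k, l, hs)" by (cases p)
    have len: "length hs = r" using that p by simp
    have "F p = (\<Sum>ks | admissible ks \<and> key ks = p. mcoeff (zeta_qt ks * u_monomial r k l hs) M)"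
      by (simp add: F_def p xi0_def key_iff[OF len] sum_distrib_right)
    also have "\<dots> = (\<Sum>ks | admissible ks \<and> key ks = p. c ks)"
      using u_monomial_eq_wt[of _ r hs] assms(1)
      by (intro sum.cong refl) (auto simp: c_def p key_iff[OF len] admissible_def len)
    finally show ?thesis .
  qed
  have "mcoeff (Psi0 r) M = infsum F {(k, l, hs). length hs = r}"
    by (simp add: Psi0_def F_def)
  also have "\<dots> = infsum F (key ` P)"
  proof (rule infsum_cong_neutral)
    fix p assume p: "p \<in> {(k, l, hs). length hs = r} - key ` P"
    have "c ks = 0" if "admissible ks" "key ks = p" for ks
      using p that unfolding c_def P_def B_def by (intro mcoeff_wt_eq_0) force
    thus "F p = 0" using p by (subst F) auto
  qed (auto simp: key_def)
  also have "\<dots> = (\<Sum>p\<in>key ` P. F p)" using finP by simp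
  also have "\<dots> = (\<Sum>p\<in>key ` P. \<Sum>ks | ks \<in> P \<and> key ks = p. c ks)"
  proof (intro sum.cong refl)
    fix p assume "p \<in> key ` P"
    thus "F p = (\<Sum>ks | ks \<in> P \<and> key ks = p. c ks)"
      by (subst F) (auto simp: key_def P_def intro!: sum.cong)
  qed
  also have "\<dots> = (\<Sum>ks\<in>P. c ks)"
    using sum.image_gen[OF finP, of c key] by simp
  also have "\<dots> = (\<Sum>ks\<in>S. c ks)"
    using assms unfolding P_def B_def c_def
    by (intro sum.mono_neutral_left) (auto intro!: mcoeff_wt_eq_0)
  finally show ?thesis by (simp add: c_def)
qed

subsection \<open>Summation over the entries\<close>

text \<open>Closed form of the sum over all entries k: from k = r + 1 on, the contributions form a
  geometric progression with ratio q^m u_1/[m].\<close>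

definition F_ser :: "nat \<Rightarrow> nat \<Rightarrow> pseries" where
  "F_ser r m = (\<Sum>k=1..r. mconst (zfac m k) * u_ser (k + 1)) +
     mconst (zfac m (r + 1)) * u_ser (r + 2) * mgeom (mconst (fps_X ^ m / qint fps_X m) * u_ser 1)"

definition G_ser :: "nat \<Rightarrow> nat \<Rightarrow> pseries" where
  "G_ser r m = F_ser r m - mconst (zfac m 1) * u_ser 2"

lemma order_ge_cmult_var [simp]: "order_ge 1 (f * mvar v)"
  by (rule order_ge_mult_left[OF order_ge_mvar])

lemma order_ge_F_ser [simp]: "order_ge 1 (F_ser r m)"
  unfolding F_ser_def
  by (intro order_ge_add order_ge_sum order_ge_cmult_var order_ge_mult_right)

lemma order_ge_t_F_ser [simp]: "order_ge 1 (t_ser * F_ser r m)"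
  by (intro order_ge_mult_left order_ge_F_ser)

lemma F_ser_approx:
  assumes "m \<ge> 1"
  shows "order_ge (Suc d) (F_ser r m - (\<Sum>k=1..r + 1 + d. mconst (zfac m k) * wt_entry r k))"
proof -
  define y :: "rat fps" where "y = fps_X ^ m / qint fps_X m"
  have y: "y = fps_X ^ m * inverse (qint fps_X m)"
    using qint_fps_X_nth_0[OF assms] by (simp add: y_def fps_divide_unit)
  have z: "zfac m (r + 1 + i) = zfac m (r + 1) * y ^ i" for i
  proof -
    have "(r + 1 + i - 1) * m = (r + 1 - 1) * m + m * i" by (simp add: algebra_simps)
    hence "(fps_X :: rat fps) ^ ((r + 1 + i - 1) * m) = fps_X ^ ((r + 1 - 1) * m) * (fps_X ^ m) ^ i"
      by (simp only: power_add power_mult)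
    thus ?thesis using assms
      by (simp only: zfac_eq y power_add[of _ "r + 1" i] power_mult_distrib mult_ac)
  qed
  have "(\<Sum>k=1..r + 1 + d. mconst (zfac m k) * wt_entry r k) =
      (\<Sum>k=1..r. mconst (zfac m k) * wt_entry r k) +
      (\<Sum>k=r + 1..r + 1 + d. mconst (zfac m k) * wt_entry r k)"
    using sum.ub_add_nat[of 1 r "\<lambda>k. mconst (zfac m k) * wt_entry r k" "1 + d"] by (simp add: add.assoc)
  also have "(\<Sum>k=1..r. mconst (zfac m k) * wt_entry r k) = (\<Sum>k=1..r. mconst (zfac m k) * u_ser (k + 1))"
    by (intro sum.cong) (auto simp: wt_entry_def)
  also have "(\<Sum>k=r + 1..r + 1 + d. mconst (zfac m k) * wt_entry r k) =
      (\<Sum>i\<le>d. mconst (zfac m (r + 1 + i)) * wt_entry r (r + 1 + i))"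
    by (rule sum.reindex_bij_witness[of _ "\<lambda>i. r + 1 + i" "\<lambda>k. k - r - 1"]) auto
  also have "\<dots> = mconst (zfac m (r + 1)) * u_ser (r + 2) * (\<Sum>i\<le>d. (mconst y * u_ser 1) ^ i)"
    unfolding sum_distrib_left
    by (intro sum.cong refl, subst z)
       (simp add: wt_entry_def mconst_mult mconst_power power_mult_distrib mult_ac)
  finally have "F_ser r m - (\<Sum>k=1..r + 1 + d. mconst (zfac m k) * wt_entry r k) =
      mconst (zfac m (r + 1)) * u_ser (r + 2) *
        (mgeom (mconst y * u_ser 1) - (\<Sum>i\<le>d. (mconst y * u_ser 1) ^ i))"
    by (simp add: F_ser_def y_def algebra_simps)
  thus ?thesis by (simp only: order_ge_mult_left order_ge_mgeom_diff order_ge_cmult_var)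
qed

section \<open>Recursion in the truncation for sums over boxes of indices\<close>

definition index_box :: "nat \<Rightarrow> nat \<Rightarrow> nat list set" where
  "index_box B n = {ks. set ks \<subseteq> {1..B} \<and> length ks \<le> n}"

lemma finite_index_box [simp]: "finite (index_box B n)"
  unfolding index_box_def by (rule finite_lists_length_le) simp

text \<open>Entries and depth are bounded separately, so removing the first entry leaves a full box
  again and the sum becomes a product sum.\<close>

lemma sum_index_box_Suc:
  fixes g :: "nat list \<Rightarrow> 'a::comm_monoid_add"
  assumes "lo \<ge> 1"
  shows "(\<Sum>ks | ks \<in> index_box B (Suc n) \<and> ks \<noteq> [] \<and> hd ks \<ge> lo. g ks) =
    (\<Sum>k=lo..B. \<Sum>ks\<in>index_box B n. g (k # ks))"
proof -
  have "(\<Sum>k=lo..B. \<Sum>ks\<in>index_box B n. g (k # ks)) = (\<Sum>(k, ks)\<in>{lo..B} \<times> index_box B n. g (k # ks))"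
    by (rule sum.cartesian_product)
  also have "\<dots> = (\<Sum>ks | ks \<in> index_box B (Suc n) \<and> ks \<noteq> [] \<and> hd ks \<ge> lo. g ks)"
    using assms
    by (intro sum.reindex_bij_witness[of _ "\<lambda>ks. (hd ks, tl ks)" "\<lambda>(k, ks). k # ks"])
       (auto simp: index_box_def neq_Nil_conv)
  finally show ?thesis ..
qed

definition all_sum :: "nat \<Rightarrow> nat \<Rightarrow> nat \<Rightarrow> nat \<Rightarrow> pseries" where
  "all_sum r B n N = (\<Sum>ks\<in>index_box B n. zeta_t_trunc ks N * wt r ks)"

definition head_sum :: "nat \<Rightarrow> nat \<Rightarrow> nat \<Rightarrow> nat \<Rightarrow> nat \<Rightarrow> pseries" where
  "head_sum lo r B n N = (\<Sum>ks | ks \<in> index_box B n \<and> ks \<noteq> [] \<and> hd ks \<ge> lo. zeta_t_trunc ks N * wt r ks)"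

lemma all_sum_eq: "all_sum r B n N = 1 + head_sum 1 r B n N"
proof -
  have "index_box B n = insert [] {ks \<in> index_box B n. ks \<noteq> [] \<and> hd ks \<ge> 1}"
    by (auto simp: index_box_def neq_Nil_conv)
  hence "all_sum r B n N = (\<Sum>ks\<in>insert [] {ks \<in> index_box B n. ks \<noteq> [] \<and> hd ks \<ge> 1}. zeta_t_trunc ks N * wt r ks)"
    unfolding all_sum_def by simp
  also have "\<dots> = 1 + head_sum 1 r B n N"
    by (subst sum.insert) (auto simp: head_sum_def)
  finally show ?thesis .
qed

lemma head_sum_step:
  assumes "lo \<ge> 1"
  shows "head_sum lo r B (Suc n) (Suc N) - head_sum lo r B (Suc n) N =
    (\<Sum>k=lo..B. mconst (zfac (Suc N) k) * wt_entry r k) *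
      (all_sum r B n N + t_ser * (all_sum r B n (Suc N) - all_sum r B n N))"
proof -
  have "head_sum lo r B (Suc n) (Suc N) - head_sum lo r B (Suc n) N =
      (\<Sum>k=lo..B. \<Sum>ks\<in>index_box B n. (mconst (zfac (Suc N) k) * wt_entry r k) *
        ((zeta_t_trunc ks N + t_ser * (zeta_t_trunc ks (Suc N) - zeta_t_trunc ks N)) * wt r ks))"
    unfolding head_sum_def sum_index_box_Suc[OF assms]
    by (simp add: sum_subtractf[symmetric] algebra_simps)
  also have "\<dots> = (\<Sum>k=lo..B. mconst (zfac (Suc N) k) * wt_entry r k) *
      (\<Sum>ks\<in>index_box B n.
        (zeta_t_trunc ks N + t_ser * (zeta_t_trunc ks (Suc N) - zeta_t_trunc ks N)) * wt r ks)"
    by (rule sum_product[symmetric])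
  also have "(\<Sum>ks\<in>index_box B n.
        (zeta_t_trunc ks N + t_ser * (zeta_t_trunc ks (Suc N) - zeta_t_trunc ks N)) * wt r ks) =
      all_sum r B n N + t_ser * (all_sum r B n (Suc N) - all_sum r B n N)"
    by (simp add: all_sum_def sum_distrib_left sum.distrib sum_subtractf algebra_simps)
  finally show ?thesis .
qed

lemma head_sum_0: "head_sum lo r B n 0 = 0"
  unfolding head_sum_def by (rule sum.neutral) (auto simp: neq_Nil_conv)

lemma all_sum_Suc_order: "order_ge (Suc n) (all_sum r B (Suc n) N - all_sum r B n N)"
proof -
  have "all_sum r B (Suc n) N - all_sum r B n N =
      (\<Sum>ks\<in>index_box B (Suc n) - index_box B n. zeta_t_trunc ks N * wt r ks)"
    unfolding all_sum_def
    by (intro sum_diff[symmetric])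
       (auto simp: index_box_def[of B n] index_box_def[of B "Suc n"] intro: finite_lists_length_le)
  also have "order_ge (Suc n) \<dots>"
  proof (intro order_ge_sum order_ge_mult_left)
    fix ks assume "ks \<in> index_box B (Suc n) - index_box B n"
    hence "length ks = Suc n" by (auto simp: index_box_def)
    thus "order_ge (Suc n) (wt r ks)" using order_ge_wt_length[of ks r] by simp
  qed
  finally show ?thesis .
qed

definition D_ser :: "nat \<Rightarrow> nat \<Rightarrow> pseries" where
  "D_ser r m = mgeom (t_ser * F_ser r m)"

lemma D_ser: "(1 - t_ser * F_ser r m) * D_ser r m = 1"
  unfolding D_ser_def by (rule mgeom[OF order_ge_t_F_ser])

definition P_ser :: "nat \<Rightarrow> nat \<Rightarrow> pseries" where
  "P_ser r N = (\<Prod>m=1..N. (1 + (1 - t_ser) * F_ser r m) * D_ser r m)"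

lemma P_ser_Suc: "P_ser r (Suc N) = P_ser r N * (1 + F_ser r (Suc N) * D_ser r (Suc N))"
proof -
  define F D where "F = F_ser r (Suc N)" and "D = D_ser r (Suc N)"
  have "(1 + (1 - t_ser) * F) * D = (1 - t_ser * F) * D + F * D" by (simp add: algebra_simps)
  also have "(1 - t_ser * F) * D = 1" unfolding F_def D_def by (rule D_ser)
  finally show ?thesis by (simp add: P_ser_def F_def D_def)
qed

definition W_ser :: "nat \<Rightarrow> nat \<Rightarrow> pseries" where
  "W_ser r m = G_ser r m * D_ser r m * P_ser r (m - 1)"

text \<open>Modulo degree d + 1 the sums S and S' for N and N + 1 satisfy S' - S = F (S + t (S' -
  S)), that is (1 - tF) S' = (1 + (1 - t) F) S, which is the recursion of \<open>P_ser\<close>. Both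
  errors have degree at least d + 1: replacing depth d + 1 by d, and cutting the entries at
  B.\<close>

lemma all_sum_approx:
  assumes "B \<ge> r + 1 + d"
  shows "order_ge (Suc d) (all_sum r B d N - P_ser r N)"
proof (induction N)
  case 0
  show ?case by (simp add: all_sum_eq head_sum_0 P_ser_def)
next
  case (Suc N)
  define F D where "F = F_ser r (Suc N)" and "D = D_ser r (Suc N)"
  define FB where "FB = (\<Sum>k=1..B. mconst (zfac (Suc N) k) * wt_entry r k)"
  define S S' where "S = all_sum r B d N" and "S' = all_sum r B d (Suc N)"
  define R R' where "R = all_sum r B (Suc d) N" and "R' = all_sum r B (Suc d) (Suc N)"
  have FB: "order_ge (Suc d) (F - FB)"
    using F_ser_approx[of "Suc N" "B - r - 1" r] assms
    by (auto simp: F_def FB_def intro: order_ge_mono)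
  have R: "R' - R = FB * (S + t_ser * (S' - S))"
    unfolding R_def R'_def S_def S'_def FB_def all_sum_eq[of r B "Suc d"]
    using head_sum_step[of 1 r B d N] by simp
  have RS: "order_ge (Suc d) (R - S)" "order_ge (Suc d) (R' - S')"
    unfolding R_def R'_def S_def S'_def by (rule all_sum_Suc_order)+
  have P: "P_ser r (Suc N) = P_ser r N * (1 + F * D)"
    by (simp add: P_ser_Suc F_def D_def)
  \<comment> \<open>Multiplication by D, the inverse of 1 - tF, solves the recursion for S' - S; the
    last summand vanishes by \<open>R\<close>.\<close>
  have "(S' - S) * ((1 - t_ser * F) * D) - F * D * S = D * ((R - S) - (R' - S') - (F - FB) * (S + t_ser * (S' - S)))
     + D * (R' - R - FB * (S + t_ser * (S' - S)))"
    by (simp add: algebra_simps)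
  hence "S' - S - F * D * S = D * ((R - S) - (R' - S') - (F - FB) * (S + t_ser * (S' - S)))"
    using D_ser[of r "Suc N"] R by (simp add: F_def D_def)
  hence 1: "order_ge (Suc d) (S' - S - F * D * S)"
    by (simp only: order_ge_mult_left order_ge_mult_right order_ge_diff RS FB)
  have "S' - P_ser r (Suc N) = (S' - S - F * D * S) + (1 + F * D) * (S - P_ser r N)"
    unfolding P by (simp add: algebra_simps)
  thus ?case using 1 Suc unfolding S_def S'_def
    by (simp only: order_ge_add order_ge_mult_left)
qed

text \<open>The same increment with leading entry at least 2. The tail factor P + t (P (1 + F D) -
  P) equals P D because D = 1 + t F D.\<close>

lemma head_sum_2_approx:
  assumes "B \<ge> r + 1 + d" "r \<ge> 1"
  shows "order_ge (Suc d) (head_sum 2 r B (Suc d) N - (\<Sum>m=1..N. W_ser r m))"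
proof (induction N)
  case 0
  show ?case by (simp add: head_sum_0)
next
  case (Suc N)
  define F D G P where "F = F_ser r (Suc N)" and "D = D_ser r (Suc N)"
    and "G = G_ser r (Suc N)" and "P = P_ser r N"
  define GB where "GB = (\<Sum>k=2..B. mconst (zfac (Suc N) k) * wt_entry r k)"
  define S S' where "S = all_sum r B d N" and "S' = all_sum r B d (Suc N)"
  have "(\<Sum>k=1..B. mconst (zfac (Suc N) k) * wt_entry r k) = mconst (zfac (Suc N) 1) * u_ser 2 + GB"
    unfolding GB_def using assms
    by (subst sum.atLeast_Suc_atMost) (auto simp: wt_entry_def numeral_2_eq_2)
  hence GB: "order_ge (Suc d) (G - GB)"
    using F_ser_approx[of "Suc N" "B - r - 1" r] assms
    by (auto simp: G_def G_ser_def algebra_simps intro: order_ge_mono)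
  have D: "D = 1 + t_ser * F * D" using D_ser[of r "Suc N"] by (simp add: F_def D_def algebra_simps)
  have P': "P_ser r (Suc N) = P * (1 + F * D)"
    by (simp add: P_ser_Suc F_def D_def P_def)
  have S: "order_ge (Suc d) (S - P)" "order_ge (Suc d) (S' - P * (1 + F * D))"
    using all_sum_approx[OF assms(1)] unfolding S_def S'_def P_def P'[unfolded P_def, symmetric] by auto
  have W: "W_ser r (Suc N) = G * (P + t_ser * (P * (1 + F * D) - P))"
  proof -
    have "W_ser r (Suc N) = G * (1 + t_ser * F * D) * P"
      using D by (simp add: W_ser_def G_def D_def P_def)
    thus ?thesis by (simp add: algebra_simps)
  qed
  have "GB * (S + t_ser * (S' - S)) - W_ser r (Suc N) =
      GB * ((S - P) + t_ser * ((S' - P * (1 + F * D)) - (S - P)))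
       - (G - GB) * (P + t_ser * (P * (1 + F * D) - P))"
    unfolding W by (simp add: algebra_simps)
  hence 1: "order_ge (Suc d) (GB * (S + t_ser * (S' - S)) - W_ser r (Suc N))"
    by (simp only: order_ge_mult_left order_ge_mult_right order_ge_diff order_ge_add S GB)
  have "head_sum 2 r B (Suc d) (Suc N) - (\<Sum>m=1..Suc N. W_ser r m) =
      (head_sum 2 r B (Suc d) N - (\<Sum>m=1..N. W_ser r m)) + (GB * (S + t_ser * (S' - S)) - W_ser r (Suc N))"
    using head_sum_step[of 2 r B d N] by (simp add: GB_def S_def S'_def algebra_simps)
  thus ?case using 1 Suc by (simp only: order_ge_add)
qed

lemma q_sums_Psi0:
  assumes "r \<ge> 1"
  shows "q_sums (\<lambda>n. W_ser r (Suc n)) (Psi0 r)"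
proof -
  have "q_order_ge (Suc N) (Psi0 r - (\<Sum>m=1..N. W_ser r m))" for N
    unfolding q_order_ge_def
  proof safe
    fix M :: "pvar multiset" and k :: nat assume k: "k < Suc N"
    \<comment> \<open>Indices of weight above d do not reach M by \<open>mcoeff_wt_eq_0\<close>, and
      an error of degree d + 1 is invisible at M because size M \<le> d. Inside this box the
      approximations become equalities at M.\<close>
    define d B where "d = (r + 1) * size M" and "B = r + 1 + d"
    define S where "S = {ks \<in> index_box B (Suc d). ks \<noteq> [] \<and> hd ks \<ge> 2}"
    have adm: "S \<subseteq> Collect admissible"
      by (fastforce simp: S_def index_box_def admissible_def)
    have fin: "finite S" by (simp add: S_def)
    have sub: "{ks. admissible ks \<and> sum_list ks \<le> (r + 1) * size M} \<subseteq> S"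
    proof safe
      fix ks assume ks: "admissible ks" "sum_list ks \<le> (r + 1) * size M"
      have "length ks \<le> sum_list ks"
        using sum_list_eq_heights[of ks 0] ks(1) by (auto simp: admissible_def)
      moreover have "x \<le> sum_list ks" if "x \<in> set ks" for x
        using member_le_sum_list[OF that] by simp
      ultimately show "ks \<in> S" using ks
        unfolding S_def index_box_def B_def d_def admissible_def by fastforce
    qed
    have "q_order_ge (Suc N) (\<Sum>ks\<in>S. wt r ks * (zeta_qt ks - zeta_t_trunc ks N))"
      using adm by (intro q_order_ge_sum q_order_ge_mult_left zeta_qt_approx) auto
    hence "fps_nth (mcoeff (\<Sum>ks\<in>S. wt r ks * (zeta_qt ks - zeta_t_trunc ks N)) M) k = 0"
      using k unfolding q_order_ge_def by blast
    moreover have "(\<Sum>ks\<in>S. wt r ks * (zeta_qt ks - zeta_t_trunc ks N)) =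
        (\<Sum>ks\<in>S. zeta_qt ks * wt r ks) - head_sum 2 r B (Suc d) N"
      by (simp add: head_sum_def S_def sum_subtractf[symmetric] algebra_simps)
    moreover have "mcoeff (Psi0 r) M = mcoeff (\<Sum>ks\<in>S. zeta_qt ks * wt r ks) M"
      using mcoeff_Psi0[OF assms fin adm sub] by simp
    moreover have "mcoeff (head_sum 2 r B (Suc d) N) M = mcoeff (\<Sum>m=1..N. W_ser r m) M"
    proof -
      have "size M < Suc d" by (simp add: d_def)
      thus ?thesis using head_sum_2_approx[of r d B N] assms
        unfolding order_ge_def B_def by (metis eq_iff_diff_eq_0 mcoeff_diff order_refl)
    qed
    ultimately show "fps_nth (mcoeff (Psi0 r - (\<Sum>m=1..N. W_ser r m)) M) k = 0" by simp
  qed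
  moreover have "(\<Sum>m=1..N. W_ser r m) = (\<Sum>n<N. W_ser r (Suc n))" for N
    by (rule sum.reindex_bij_witness[of _ Suc "\<lambda>m. m - 1"]) auto
  ultimately show ?thesis
    unfolding q_sums_def by (metis le_SucI q_order_ge_mono)
qed

section \<open>Identities in a field\<close>

subsection \<open>Polynomial identities for the parameters\<close>

lemma prod_add_eq_esym:
  fixes X :: "'a::comm_ring_1"
  shows "(\<Prod>i=1..n. X + f i) = (\<Sum>j=0..n. esym n j f * X ^ (n - j))"
proof -
  have "(\<Prod>i=1..n. X + f i) = (\<Sum>S\<in>Pow {1..n}. (\<Prod>i\<in>S. f i) * X ^ card ({1..n} - S))"
    using prod_add[of "{1..n}" f "\<lambda>_. X"] by (simp add: add.commute)
  also have "\<dots> = (\<Sum>S\<in>Pow {1..n}. (\<Prod>i\<in>S. f i) * X ^ (n - card S))"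
    by (intro sum.cong refl) (auto simp: card_Diff_subset finite_subset)
  also have "\<dots> = (\<Sum>j=0..n. \<Sum>S | S \<in> Pow {1..n} \<and> card S = j. (\<Prod>i\<in>S. f i) * X ^ (n - card S))"
  proof (rule sum.group[symmetric])
    show "card ` Pow {1..n} \<subseteq> {0..n}"
      using card_mono[of "{1..n}"] by fastforce
  qed auto
  also have "\<dots> = (\<Sum>j=0..n. esym n j f * X ^ (n - j))"
    by (intro sum.cong refl) (simp add: esym_def sum_distrib_right)
  finally show ?thesis .
qed

lemma sum_power_Suc:
  fixes X :: "'a::comm_ring_1"
  shows "(\<Sum>k=2..Suc r + 1. g k * X ^ (Suc r + 1 - k)) = X * (\<Sum>k=2..r + 1. g k * X ^ (r + 1 - k)) + g (r + 2)"
proof -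
  have "{2..Suc r + 1} = insert (r + 2) {2..r + 1}" by auto
  moreover have "(\<Sum>k=2..r + 1. g k * X ^ (Suc r + 1 - k)) = X * (\<Sum>k=2..r + 1. g k * X ^ (r + 1 - k))"
    unfolding sum_distrib_left by (intro sum.cong refl) (auto simp: Suc_diff_le mult_ac)
  ultimately show ?thesis by simp
qed

lemma geometric_sum_2:
  fixes A B :: "'a::comm_ring_1"
  shows "(A - B) * (\<Sum>k=2..r + 1. A ^ (r + 1 - k) * B ^ (k - 2)) = A ^ r - B ^ r"
proof (induction r)
  case (Suc r)
  have "(\<Sum>k=2..Suc r + 1. A ^ (Suc r + 1 - k) * B ^ (k - 2)) =
      A * (\<Sum>k=2..r + 1. A ^ (r + 1 - k) * B ^ (k - 2)) + B ^ r"
    using sum_power_Suc[of "\<lambda>k. B ^ (k - 2)" A r] by (simp only: mult.commute) simp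
  hence "(A - B) * (\<Sum>k=2..Suc r + 1. A ^ (Suc r + 1 - k) * B ^ (k - 2)) =
      A * (A ^ r - B ^ r) + (A - B) * B ^ r"
    unfolding Suc.IH[symmetric] by (simp add: algebra_simps)
  thus ?case by (simp add: algebra_simps)
qed simp

text \<open>Applied with c = x_1: the prescribed elementary symmetric polynomials contain x_(j+1) -
  x_1 x_j because these are the coefficients of a product with X - x_1.\<close>

lemma synthetic_division:
  fixes X c :: "'a::comm_ring_1"
  shows "y 2 * X ^ r + (\<Sum>j=2..r + 1. (y (j + 1) - c * y j) * X ^ (r + 1 - j)) =
    (X - c) * (\<Sum>j=2..r + 1. y j * X ^ (r + 1 - j)) + y (r + 2)"
proof (induction r)
  case (Suc r)
  have s: "(\<Sum>j=2..Suc r + 1. h j * X ^ (Suc r + 1 - j)) = X * (\<Sum>j=2..r + 1. h j * X ^ (r + 1 - j)) + h (r + 2)"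
    for h by (rule sum_power_Suc)
  have "y 2 * X ^ Suc r + (\<Sum>j=2..Suc r + 1. (y (j + 1) - c * y j) * X ^ (Suc r + 1 - j)) =
      X * (y 2 * X ^ r + (\<Sum>j=2..r + 1. (y (j + 1) - c * y j) * X ^ (r + 1 - j))) + (y (r + 3) - c * y (r + 2))"
    unfolding s by (simp add: algebra_simps numeral_3_eq_3)
  also have "\<dots> = (X - c) * (\<Sum>j=2..Suc r + 1. y j * X ^ (Suc r + 1 - j)) + y (Suc r + 2)"
    unfolding Suc.IH s by (simp add: algebra_simps numeral_3_eq_3)
  finally show ?case .
qed (simp add: numeral_2_eq_2)

text \<open>Numerator of F_m over X^r (X - x_1) with X = [m] and q^m written as 1 - (1-q) X. The
  last summand comes from the geometric tail.\<close>

definition F_num :: "nat \<Rightarrow> 'a::field \<Rightarrow> (nat \<Rightarrow> 'a) \<Rightarrow> 'a \<Rightarrow> 'a" where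
  "F_num r q u X =
     (\<Sum>k=2..r + 1. u k * ((1 - (1 - q) * X) ^ (k - 2) * X ^ (r + 1 - k))) * (X - x_par r q u 1) +
     u (r + 2) * (1 - (1 - q) * X) ^ r / (1 + (1 - q) * u 1)"

text \<open>With Q = 1 - (1-q) X, the first two factors multiply to u (X/u - Q), which closes a
  finite geometric sum in X/u and Q. It serves to eliminate the negative powers of u_1 in x_j and in
  c_m.\<close>

lemma geometric_sum_u1:
  fixes q :: "'a::field"
  assumes "u \<noteq> 0" "1 + (1 - q) * u \<noteq> 0"
  shows "(1 + (1 - q) * u) * (X - u / (1 + (1 - q) * u)) *
      (\<Sum>k=2..r + 1. (1 / u) ^ (r + 2 - k) * ((1 - (1 - q) * X) ^ (k - 2) * X ^ (r + 1 - k))) =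
     (X / u) ^ r - (1 - (1 - q) * X) ^ r"
proof -
  define Q where "Q = 1 - (1 - q) * X"
  have "(1 + (1 - q) * u) * (X - u / (1 + (1 - q) * u)) = u * (X / u - Q)"
    using assms by (simp add: Q_def field_simps)
  moreover have "(\<Sum>k=2..r + 1. (1 / u) ^ (r + 2 - k) * (Q ^ (k - 2) * X ^ (r + 1 - k))) =
      (1 / u) * (\<Sum>k=2..r + 1. (X / u) ^ (r + 1 - k) * Q ^ (k - 2))"
    unfolding sum_distrib_left
    by (intro sum.cong refl) (auto simp: Suc_diff_le power_divide field_simps)
  ultimately show ?thesis
    using geometric_sum_2[of "X / u" Q r] assms(1) by (simp add: Q_def)
qed

lemma x_par_one: "x_par r q u 1 = u 1 / (1 + (1 - q) * u 1)"
  by (simp add: x_par_def)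

lemma x_par_eq:
  fixes q :: "'a::field"
  assumes "u 1 \<noteq> 0" "2 \<le> j" "j \<le> r + 2"
  shows "x_par r q u j =
     (\<Sum>k=j..r + 1. of_nat ((k - 2) choose (j - 2)) * (q - 1) ^ (k - j) * (u k - (1 / u 1) ^ (r + 2 - k) * u (r + 2)))
      + u (r + 2) * (1 / u 1) ^ (r + 2 - j) * (1 / (1 + (1 - q) * u 1)) ^ (j - 1)"
proof -
  have key: "(1 / u 1 ^ (r + 2 - j)) * (of_nat ((k - 2) choose (j - 2)) * ((q - 1) * u 1) ^ (k - j) *
            (u 1 ^ (r + 2 - k) * u k - u (r + 2))) =
      of_nat ((k - 2) choose (j - 2)) * (q - 1) ^ (k - j) * (u k - (1 / u 1) ^ (r + 2 - k) * u (r + 2))"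
    if "k \<in> {j..r + 1}" for k
  proof -
    have "r + 2 - j = (r + 2 - k) + (k - j)" using that by auto
    hence e: "u 1 ^ (r + 2 - j) = u 1 ^ (r + 2 - k) * u 1 ^ (k - j)" by (simp only: power_add)
    have gen: "1 / (A * B) * (c * (C * B) * (A * y - v)) = c * C * (y - 1 / A * v)"
      if "A \<noteq> 0" "B \<noteq> 0" for A B C c y v :: 'a
      using that by (simp add: field_simps)
    show ?thesis
      unfolding e power_mult_distrib power_divide power_one by (rule gen) (use assms(1) in auto)
  qed
  have "j \<noteq> 1" using assms(2) by simp
  have "x_par r q u j = (\<Sum>k=j..r + 1. (1 / u 1 ^ (r + 2 - j)) *
      (of_nat ((k - 2) choose (j - 2)) * ((q - 1) * u 1) ^ (k - j) * (u 1 ^ (r + 2 - k) * u k - u (r + 2)))) +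
      (1 / u 1 ^ (r + 2 - j)) * (u (r + 2) / (1 + (1 - q) * u 1) ^ (j - 1))"
    unfolding x_par_def if_not_P[OF \<open>j \<noteq> 1\<close>] distrib_left sum_distrib_left ..
  also have "(1 / u 1 ^ (r + 2 - j)) * (u (r + 2) / (1 + (1 - q) * u 1) ^ (j - 1)) =
      u (r + 2) * (1 / u 1) ^ (r + 2 - j) * (1 / (1 + (1 - q) * u 1)) ^ (j - 1)"
    by (simp add: power_divide)
  finally show ?thesis by (simp only: key cong: sum.cong)
qed

text \<open>Origin of the binomial coefficients in x_j: they rewrite the products of powers of q^m
  and [m] as polynomials in [m] alone.\<close>

lemma binomial_Q:
  fixes q X :: "'a::comm_ring_1"
  assumes "2 \<le> k" "k \<le> r + 1"
  shows "(\<Sum>j=2..k. of_nat ((k - 2) choose (j - 2)) * (q - 1) ^ (k - j) * X ^ (r + 1 - j)) =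
    (1 - (1 - q) * X) ^ (k - 2) * X ^ (r + 1 - k)"
proof -
  have "(1 - (1 - q) * X) ^ (k - 2) = (1 + (q - 1) * X) ^ (k - 2)" by (simp add: algebra_simps)
  also have "\<dots> = (\<Sum>i\<le>k - 2. of_nat ((k - 2) choose i) * ((q - 1) * X) ^ (k - 2 - i))"
    by (simp add: binomial_ring)
  also have "\<dots> * X ^ (r + 1 - k) =
      (\<Sum>i\<le>k - 2. of_nat ((k - 2) choose i) * (q - 1) ^ (k - 2 - i) * X ^ (r - 1 - i))"
    unfolding sum_distrib_right
  proof (intro sum.cong refl)
    fix i assume i: "i \<in> {..k - 2}"
    have "r - 1 - i = (k - 2 - i) + (r + 1 - k)" using i assms by auto
    thus "of_nat ((k - 2) choose i) * ((q - 1) * X) ^ (k - 2 - i) * X ^ (r + 1 - k) =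
        of_nat ((k - 2) choose i) * (q - 1) ^ (k - 2 - i) * X ^ (r - 1 - i)"
      by (simp only: power_add power_mult_distrib mult_ac)
  qed
  also have "\<dots> = (\<Sum>j=2..k. of_nat ((k - 2) choose (j - 2)) * (q - 1) ^ (k - j) * X ^ (r + 1 - j))"
    using assms by (intro sum.reindex_bij_witness[of _ "\<lambda>j. j - 2" "\<lambda>i. i + 2"]) auto
  finally show ?thesis ..
qed

text \<open>By synthetic division the left side is (X - x_1) times the sum of the x_j X^(r+1-j),
  plus x_(r+2). The parts with negative powers of u_1 form two geometric sums, \<open>g1\<close> and
  \<open>g2\<close>; after multiplication by X - x_1 both contain the same multiple of (X/u_1)^r,
  which cancels. The remaining w^r term of \<open>g2\<close> is cancelled by x_(r+2).\<close>

lemma x_par_polynomial: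
  fixes q :: "'a::field" and u :: "nat \<Rightarrow> 'a" and r :: nat
  assumes "u 1 \<noteq> 0" "1 + (1 - q) * u 1 \<noteq> 0"
  defines "x \<equiv> x_par r q u"
  shows "x 2 * X ^ r + (\<Sum>j=2..r + 1. (x (j + 1) - x 1 * x j) * X ^ (r + 1 - j)) = F_num r q u X"
proof -
  define Q p V w where "Q = 1 - (1 - q) * X" and "p = 1 / u 1" and "V = 1 + (1 - q) * u 1" and "w = 1 / V"
  define v where "v = u (r + 2)"
  define g1 where "g1 = (\<Sum>k=2..r + 1. p ^ (r + 2 - k) * (Q ^ (k - 2) * X ^ (r + 1 - k)))"
  define g2 where "g2 = (\<Sum>j=2..r + 1. p ^ (r + 2 - j) * w ^ (j - 1) * X ^ (r + 1 - j))"
  define U where "U = (\<Sum>k=2..r + 1. u k * (Q ^ (k - 2) * X ^ (r + 1 - k)))"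
  have x1: "x 1 = u 1 * w" unfolding x_def x_par_one by (simp add: w_def V_def)
  have xl: "x (r + 2) = v * w * w ^ r"
    using assms(1) by (simp add: x_def x_par_eq v_def w_def V_def)
  have "(\<Sum>j=2..r + 1. x j * X ^ (r + 1 - j)) =
      (\<Sum>j=2..r + 1. \<Sum>k=j..r + 1. (u k - p ^ (r + 2 - k) * v) *
         (of_nat ((k - 2) choose (j - 2)) * (q - 1) ^ (k - j) * X ^ (r + 1 - j))) + v * g2"
    unfolding g2_def sum_distrib_left sum.distrib[symmetric]
  proof (intro sum.cong refl)
    fix j assume j: "j \<in> {2..r + 1}"
    have xj: "x j = (\<Sum>k=j..r + 1. of_nat ((k - 2) choose (j - 2)) * (q - 1) ^ (k - j) * (u k - p ^ (r + 2 - k) * v))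
        + v * p ^ (r + 2 - j) * w ^ (j - 1)"
      unfolding x_def p_def v_def w_def V_def by (rule x_par_eq) (use j assms(1) in auto)
    show "x j * X ^ (r + 1 - j) = (\<Sum>k=j..r + 1. (u k - p ^ (r + 2 - k) * v) *
         (of_nat ((k - 2) choose (j - 2)) * (q - 1) ^ (k - j) * X ^ (r + 1 - j)))
        + v * (p ^ (r + 2 - j) * w ^ (j - 1) * X ^ (r + 1 - j))"
      unfolding xj distrib_right sum_distrib_right by (simp only: mult_ac)
  qed
  also have "(\<Sum>j=2..r + 1. \<Sum>k=j..r + 1. (u k - p ^ (r + 2 - k) * v) *
         (of_nat ((k - 2) choose (j - 2)) * (q - 1) ^ (k - j) * X ^ (r + 1 - j))) =
      (\<Sum>k=2..r + 1. \<Sum>j=2..k. (u k - p ^ (r + 2 - k) * v) *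
         (of_nat ((k - 2) choose (j - 2)) * (q - 1) ^ (k - j) * X ^ (r + 1 - j)))"
    by (subst (1 2) sum.Sigma, simp, simp, simp, simp,
        rule sum.reindex_bij_witness[of _ "\<lambda>(a, b). (b, a)" "\<lambda>(a, b). (b, a)"]) auto
  also have "\<dots> = (\<Sum>k=2..r + 1. (u k - p ^ (r + 2 - k) * v) * (Q ^ (k - 2) * X ^ (r + 1 - k)))"
    by (intro sum.cong refl, subst sum_distrib_left[symmetric], subst binomial_Q) (auto simp: Q_def)
  also have "\<dots> = U - v * g1"
    unfolding U_def g1_def sum_distrib_left sum_subtractf[symmetric]
    by (intro sum.cong refl) (simp add: algebra_simps)
  finally have T: "(\<Sum>j=2..r + 1. x j * X ^ (r + 1 - j)) = U - v * g1 + v * g2" .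
  have Vw: "V * w = 1" using assms(2) by (simp add: V_def w_def)
  have "V * (X - x 1) * g1 = (X * p) ^ r - Q ^ r"
    using geometric_sum_u1[OF assms(1,2), of X r] unfolding x_def x_par_one
    by (simp add: g1_def V_def Q_def p_def)
  hence "w * V * (X - x 1) * g1 = w * ((X * p) ^ r - Q ^ r)" by (simp only: mult.assoc)
  hence g1: "(X - x 1) * g1 = w * ((X * p) ^ r - Q ^ r)"
    using Vw by (simp add: mult.commute)
  have g2: "(X - x 1) * g2 = w * ((X * p) ^ r - w ^ r)"
  proof -
    have "g2 = p * w * (\<Sum>k=2..r + 1. (X * p) ^ (r + 1 - k) * w ^ (k - 2))"
      unfolding g2_def sum_distrib_left
    proof (intro sum.cong refl)
      fix k assume k: "k \<in> {2..r + 1}"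
      have "r + 2 - k = Suc (r + 1 - k)" "k - 1 = Suc (k - 2)" using k by auto
      thus "p ^ (r + 2 - k) * w ^ (k - 1) * X ^ (r + 1 - k) = p * w * ((X * p) ^ (r + 1 - k) * w ^ (k - 2))"
        by (simp only: power_Suc power_mult_distrib mult_ac)
    qed
    moreover have "(X - x 1) * p = X * p - w" unfolding x1 using assms(1) by (simp add: p_def diff_divide_distrib)
    moreover have "(X - x 1) * (p * w * S) = w * ((X - x 1) * p * S)" for S by (simp only: mult_ac)
    ultimately have "(X - x 1) * g2 = w * ((X * p - w) * (\<Sum>k=2..r + 1. (X * p) ^ (r + 1 - k) * w ^ (k - 2)))"
      by (simp only:)
    thus ?thesis by (simp only: geometric_sum_2)
  qed
  have "(X - x 1) * (U - v * g1 + v * g2) + v * w * w ^ r =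
      U * (X - x 1) - v * ((X - x 1) * g1) + v * ((X - x 1) * g2) + v * w * w ^ r"
    by (simp add: algebra_simps)
  also have "\<dots> = U * (X - x 1) + v * Q ^ r * w" unfolding g1 g2 by (simp add: algebra_simps)
  also have "\<dots> = F_num r q u X"
    by (simp add: F_num_def U_def Q_def v_def w_def V_def x_def)
  finally show ?thesis unfolding synthetic_division T xl .
qed

text \<open>Serves both families: c = 1 - t for \<alpha> and c = -t for \<beta>.\<close>

lemma prod_roots:
  fixes q :: "'a::field" and u :: "nat \<Rightarrow> 'a" and r :: nat
  assumes "u 1 \<noteq> 0" "1 + (1 - q) * u 1 \<noteq> 0" and r: "r \<ge> 1"
  defines "x \<equiv> x_par r q u"
  assumes "(\<Sum>i=1..r+1. f i) = c * x 2 - x 1"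
    and "\<And>j. j \<in> {2..r+1} \<Longrightarrow> esym (r + 1) j f = c * (x (j + 1) - x 1 * x j)"
  shows "(\<Prod>i=1..r+1. X + f i) = X ^ r * (X - x 1) + c * F_num r q u X"
proof -
  have e0: "esym (r + 1) 0 f = 1"
  proof -
    have "{S. S \<subseteq> {1..r + 1} \<and> card S = 0} = {{}}" by (auto simp: finite_subset)
    thus ?thesis by (simp add: esym_def)
  qed
  have e1: "esym (r + 1) 1 f = (\<Sum>i=1..r+1. f i)"
  proof -
    have "{S. S \<subseteq> {1..r + 1} \<and> card S = 1} = (\<lambda>i. {i}) ` {1..r + 1}" by (auto simp: card_1_singleton_iff)
    thus ?thesis unfolding esym_def by (simp only:) (subst sum.reindex, auto)
  qed
  have "(\<Prod>i=1..r+1. X + f i) = (\<Sum>j=0..r+1. esym (r + 1) j f * X ^ (r + 1 - j))"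
    by (rule prod_add_eq_esym)
  also have "\<dots> = X ^ (r + 1) + (c * x 2 - x 1) * X ^ r +
      (\<Sum>j=2..r+1. esym (r + 1) j f * X ^ (r + 1 - j))"
    using e0 e1 assms(5)
    by (simp add: sum.atLeast_Suc_atMost[of 0] sum.atLeast_Suc_atMost[of "Suc 0"] numeral_2_eq_2 add.assoc
        del: sum.cl_ivl_Suc)
  also have "(\<Sum>j=2..r+1. esym (r + 1) j f * X ^ (r + 1 - j)) =
      c * (\<Sum>j=2..r + 1. (x (j + 1) - x 1 * x j) * X ^ (r + 1 - j))"
    unfolding sum_distrib_left by (intro sum.cong refl, subst assms(6)) auto
  also have "X ^ (r + 1) + (c * x 2 - x 1) * X ^ r + \<dots> =
      X ^ r * (X - x 1) + c * (x 2 * X ^ r + (\<Sum>j=2..r + 1. (x (j + 1) - x 1 * x j) * X ^ (r + 1 - j)))"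
    by (simp add: algebra_simps)
  also have "\<dots> = X ^ r * (X - x 1) + c * F_num r q u X"
    using x_par_polynomial[where u = u and q = q and r = r and X = X, OF assms(1,2)] unfolding x_def by simp
  finally show ?thesis .
qed

text \<open>The contribution of k = n + 2 to the polynomial with coefficients c_m, indexed by i = r
  - m. The second binomial sum is complete; the first lacks i = 0, which causes the correction
  (-s)^n X^r.\<close>

lemma c_par_inner:
  fixes s X y :: "'a::field"
  assumes "s \<noteq> 0" "n < r"
  shows "(\<Sum>i=1..n + 1. X ^ (r - i) * (of_nat (n choose i) + s * y * of_nat (n choose (i - 1)))
      * (- s) powi (int n - int i)) =
    X ^ (r - 1 - n) * (1 - s * X) ^ n * (X - y) - (- s) ^ n * X ^ r"
proof -
  have Q: "(1 - s * X) ^ n = (\<Sum>i\<le>n. of_nat (n choose i) * (- s * X) ^ (n - i))"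
    using binomial_ring[of 1 "- s * X" n] by simp
  have "(\<Sum>i=1..n + 1. X ^ (r - i) * (of_nat (n choose i) * (- s) powi (int n - int i))) =
      (\<Sum>i=1..n. X ^ (r - n) * (of_nat (n choose i) * (- s * X) ^ (n - i)))"
  proof (rule sum.mono_neutral_cong_right)
    show "X ^ (r - i) * (of_nat (n choose i) * (- s) powi (int n - int i)) =
        X ^ (r - n) * (of_nat (n choose i) * (- s * X) ^ (n - i))" if "i \<in> {1..n}" for i
    proof -
      have "r - i = (r - n) + (n - i)" "int n - int i = int (n - i)" using that assms by auto
      thus ?thesis by (simp only: power_int_of_nat power_add power_mult_distrib mult_ac)
    qed
    show "\<forall>i\<in>{1..n + 1} - {1..n}. X ^ (r - i) * (of_nat (n choose i) * (- s) powi (int n - int i)) = 0"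
      by (auto simp: binomial_eq_0)
  qed auto
  also have "\<dots> = X ^ (r - n) * ((\<Sum>i\<le>n. of_nat (n choose i) * (- s * X) ^ (n - i)) - (- s * X) ^ n)"
    by (simp add: sum_distrib_left[symmetric] atMost_atLeast0 sum.atLeast_Suc_atMost[of 0])
  also have "\<dots> = X ^ (r - n) * (1 - s * X) ^ n - (- s) ^ n * X ^ r"
  proof -
    have "r = (r - n) + n" using assms by simp
    hence "X ^ r = X ^ (r - n) * X ^ n" by (metis power_add)
    thus ?thesis unfolding Q by (simp only: right_diff_distrib power_mult_distrib mult_ac)
  qed
  finally have 1: "(\<Sum>i=1..n + 1. X ^ (r - i) * (of_nat (n choose i) * (- s) powi (int n - int i))) =
    X ^ (r - n) * (1 - s * X) ^ n - (- s) ^ n * X ^ r" .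
  have "(\<Sum>i=1..n + 1. X ^ (r - i) * (s * of_nat (n choose (i - 1)) * (- s) powi (int n - int i))) =
      (\<Sum>i\<le>n. - (X ^ (r - 1 - n) * (of_nat (n choose i) * (- s * X) ^ (n - i))))"
  proof (rule sum.reindex_bij_witness[of _ "\<lambda>i. i + 1" "\<lambda>i. i - 1"])
    fix i assume i: "i \<in> {1..n + 1}"
    have e: "r - i = (r - 1 - n) + (n - (i - 1))" using i assms by auto
    \<comment> \<open>At i = n + 1 the exponent is -1, hence the integer power; the prefactor s
      absorbs the negative exponent.\<close>
    have "int n - int i = int (n - (i - 1)) - 1" using i by auto
    hence "(- s) powi (int n - int i) = (- s) ^ (n - (i - 1)) / (- s)"
      using power_int_diff[of "- s" "int (n - (i - 1))" 1] assms(1)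
      by (simp only: power_int_of_nat power_int_1_right neg_equal_0_iff_equal) blast
    hence p: "s * (- s) powi (int n - int i) = - ((- s) ^ (n - (i - 1)))"
      using assms(1) by (simp only: divide_minus_right mult_minus_right times_divide_eq_right
          nonzero_mult_div_cancel_left[OF assms(1)])
    have "X ^ (r - i) * (s * of_nat (n choose (i - 1)) * (- s) powi (int n - int i)) =
        X ^ (r - i) * of_nat (n choose (i - 1)) * (s * (- s) powi (int n - int i))"
      by (simp only: mult_ac)
    also have "\<dots> = - (X ^ (r - 1 - n) * (of_nat (n choose (i - 1)) * (- s * X) ^ (n - (i - 1))))"
      unfolding p e power_add power_mult_distrib by (simp only: mult_ac mult_minus_right)
    finally show "- (X ^ (r - 1 - n) * (of_nat (n choose (i - 1)) * (- s * X) ^ (n - (i - 1)))) =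
      X ^ (r - i) * (s * of_nat (n choose (i - 1)) * (- s) powi (int n - int i))" ..
  qed auto
  also have "\<dots> = - (X ^ (r - 1 - n) * (1 - s * X) ^ n)"
    unfolding Q by (simp add: sum_negf sum_distrib_left)
  finally have 2: "(\<Sum>i=1..n + 1. X ^ (r - i) * (s * of_nat (n choose (i - 1)) * (- s) powi (int n - int i))) =
    - (X ^ (r - 1 - n) * (1 - s * X) ^ n)" .
  have "(\<Sum>i=1..n + 1. X ^ (r - i) * (of_nat (n choose i) + s * y * of_nat (n choose (i - 1)))
      * (- s) powi (int n - int i)) =
     (\<Sum>i=1..n + 1. X ^ (r - i) * (of_nat (n choose i) * (- s) powi (int n - int i))) +
     y * (\<Sum>i=1..n + 1. X ^ (r - i) * (s * of_nat (n choose (i - 1)) * (- s) powi (int n - int i)))"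
    unfolding sum_distrib_left sum.distrib[symmetric] by (intro sum.cong refl) (simp add: algebra_simps)
  also have "\<dots> = X ^ (r - n) * (1 - s * X) ^ n - (- s) ^ n * X ^ r - y * (X ^ (r - 1 - n) * (1 - s * X) ^ n)"
    unfolding 1 2 by simp
  also have "X ^ (r - n) = X * X ^ (r - 1 - n)"
    using assms(2) by (metis Suc_diff_Suc diff_commute diff_Suc_eq_diff_pred power_Suc One_nat_def)
  finally show ?thesis by (simp add: algebra_simps)
qed

lemma telescope_u:
  fixes s :: "'a::comm_ring_1"
  shows "(\<Sum>k=2..r + 1. (- s) ^ (k - 2) * (u k + s * u (k + 1))) = u 2 - (- s) ^ r * u (r + 2)"
  by (induction r) (simp_all add: algebra_simps numeral_2_eq_2)

text \<open>For 3 \<le> k \<le> r + 1 the coefficient of u_k on the left is Q^(k-2) X^(r+1-k) (Q +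
  sX), and Q + sX = 1. The boundary indices 2 and r + 2 give the corrections.\<close>

lemma H_identity:
  fixes s X :: "'a::comm_ring_1"
  assumes "r \<ge> 1"
  defines "Q \<equiv> 1 - s * X"
  shows "Q * (\<Sum>k=2..r + 1. (u k + s * u (k + 1)) * (Q ^ (k - 2) * X ^ (r + 1 - k))) =
    (\<Sum>k=2..r + 1. u k * (Q ^ (k - 2) * X ^ (r + 1 - k))) + (Q - 1) * X ^ (r - 1) * u 2
      + s * Q ^ r * u (r + 2)"
  using assms(1)
proof (induction r rule: dec_induct)
  case base
  show ?case by (simp add: algebra_simps numeral_3_eq_3 numeral_2_eq_2)
next
  case (step r)
  have s: "(\<Sum>k=2..Suc r + 1. h k * (Q ^ (k - 2) * X ^ (Suc r + 1 - k))) =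
      X * (\<Sum>k=2..r + 1. h k * (Q ^ (k - 2) * X ^ (r + 1 - k))) + h (r + 2) * Q ^ r"
    for h using sum_power_Suc[of "\<lambda>k. h k * Q ^ (k - 2)" X r] by (simp add: mult.assoc)
  have "Q * (X * (\<Sum>k=2..r + 1. (u k + s * u (k + 1)) * (Q ^ (k - 2) * X ^ (r + 1 - k))) +
        (u (r + 2) + s * u (r + 2 + 1)) * Q ^ r) =
      X * (Q * (\<Sum>k=2..r + 1. (u k + s * u (k + 1)) * (Q ^ (k - 2) * X ^ (r + 1 - k)))) +
        Q * (u (r + 2) + s * u (r + 2 + 1)) * Q ^ r"
    by (simp add: algebra_simps)
  also have "\<dots> = X * (\<Sum>k=2..r + 1. u k * (Q ^ (k - 2) * X ^ (r + 1 - k))) +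
      (Q - 1) * (X * X ^ (r - 1)) * u 2 + (s * X + Q) * Q ^ r * u (r + 2) + s * (Q * Q ^ r) * u (r + 2 + 1)"
    unfolding step.IH by (simp add: algebra_simps)
  also have "s * X + Q = 1" by (simp add: Q_def)
  also have "X * X ^ (r - 1) = X ^ r" using step by (metis power_eq_if not_one_le_zero)
  finally show ?case unfolding s by (simp add: algebra_simps)
qed

text \<open>The right side is the numerator of G_m. At Q = 0 only the k = 2 term of
  \<open>F_num\<close> survives and is subtracted, so a factor Q = q^m splits off. The u_1 u_2 term
  turns -u_2 Q X^r into -u_2 Q X^(r-1) (X - x_1).\<close>

lemma c_par_polynomial:
  fixes q :: "'a::field"
  assumes "u 1 \<noteq> 0" "1 + (1 - q) * u 1 \<noteq> 0" "q \<noteq> 1" "r \<ge> 1"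
  shows "(1 - (1 - q) * X) * (1 + (1 - q) * u 1) *
     ((\<Sum>m=0..r - 1. c_par r q u m * X ^ m) + u 1 * u 2 / (1 + (1 - q) * u 1) ^ 2 * X ^ (r - 1)) =
     F_num r q u X - u 2 * X ^ (r - 1) * (X - x_par r q u 1)"
proof -
  define s Q p V w y where "s = 1 - q" and "Q = 1 - s * X" and "p = 1 / u 1" and
    "V = 1 + s * u 1" and "w = 1 / V" and "y = u 1 * w"
  define v where "v = u (r + 2)"
  have s0: "s \<noteq> 0" using assms(3) by (simp add: s_def)
  have V0: "V \<noteq> 0" using assms(2) by (simp add: V_def s_def)
  have y: "x_par r q u 1 = y" unfolding x_par_one by (simp add: y_def w_def V_def s_def)
  define D where "D k = w * (u k + s * u (k + 1)) - p ^ (r + 2 - k) * v" for k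
  have c: "c_par r q u m * X ^ m = (\<Sum>k=r-m+1..r+1. D k *
      (X ^ m * (of_nat ((k - 2) choose (r - m)) + s * y * of_nat ((k - 2) choose (r - m - 1)))
       * (- s) powi (int (k - 2) - int (r - m))))" if "m \<le> r - 1" for m
    unfolding c_par_def sum_distrib_right
  proof (intro sum.cong refl)
    fix k assume k: "k \<in> {r-m+1..r+1}"
    have i: "int k - int r + int m - 2 = int (k - 2) - int (r - m)"
      using k that assms(4) by auto
    have "int k - int r - 2 = - int (r + 2 - k)" using k by auto
    hence pw: "u 1 powi (int k - int r - 2) = p ^ (r + 2 - k)"
      by (simp only: power_int_minus power_int_of_nat p_def power_divide power_one inverse_eq_divide)
    have Vq: "1 + (1 - q) * u 1 = V" and sq: "1 - q = s" by (simp_all add: V_def s_def)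
    have d: "u k / V - p ^ (r + 2 - k) * v + s * u (k + 1) / V = D k"
      by (simp add: D_def w_def add_divide_distrib algebra_simps)
    have sy: "s * u 1 / V = s * y" by (simp add: y_def w_def)
    show "(of_nat (k - 2 choose (r - m)) + (1 - q) * u 1 / (1 + (1 - q) * u 1) * of_nat (k - 2 choose (r - m - 1))) *
         (- (1 - q)) powi (int k - int r + int m - 2) *
         (u k / (1 + (1 - q) * u 1) - u 1 powi (int k - int r - 2) * u (r + 2) +
          (1 - q) * u (k + 1) / (1 + (1 - q) * u 1)) * X ^ m =
       D k * (X ^ m * (of_nat ((k - 2) choose (r - m)) + s * y * of_nat ((k - 2) choose (r - m - 1)))
       * (- s) powi (int (k - 2) - int (r - m)))"
      unfolding Vq unfolding sq i pw v_def[symmetric] d sy by (simp only: mult_ac)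
  qed
  have "(\<Sum>m=0..r - 1. c_par r q u m * X ^ m) = (\<Sum>m=0..r - 1. \<Sum>k=r-m+1..r+1. D k *
      (X ^ m * (of_nat ((k - 2) choose (r - m)) + s * y * of_nat ((k - 2) choose (r - m - 1)))
       * (- s) powi (int (k - 2) - int (r - m))))"
    by (intro sum.cong refl c) simp
  also have "\<dots> = (\<Sum>k=2..r + 1. \<Sum>i=1..k - 2 + 1. D k *
      (X ^ (r - i) * (of_nat ((k - 2) choose i) + s * y * of_nat ((k - 2) choose (i - 1)))
       * (- s) powi (int (k - 2) - int i)))"
    using assms(4)
    by (subst (1 2) sum.Sigma, simp, simp, simp, simp,
        intro sum.reindex_bij_witness[of _ "\<lambda>(k, i). (r - i, k)" "\<lambda>(m, k). (k, r - m)"]) auto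
  also have "\<dots> = (\<Sum>k=2..r + 1. D k * (X ^ (r + 1 - k) * Q ^ (k - 2) * (X - y) - (- s) ^ (k - 2) * X ^ r))"
  proof (intro sum.cong refl)
    fix k assume k: "k \<in> {2..r + 1}"
    have "r - 1 - (k - 2) = r + 1 - k" "k - 2 < r" using k by auto
    thus "(\<Sum>i=1..k - 2 + 1. D k *
      (X ^ (r - i) * (of_nat ((k - 2) choose i) + s * y * of_nat ((k - 2) choose (i - 1)))
       * (- s) powi (int (k - 2) - int i))) =
      D k * (X ^ (r + 1 - k) * Q ^ (k - 2) * (X - y) - (- s) ^ (k - 2) * X ^ r)"
      unfolding sum_distrib_left[symmetric] Q_def using c_par_inner[OF s0, of "k - 2" r X y] by simp
  qed
  also have "\<dots> = w * (X - y) * (\<Sum>k=2..r + 1. (u k + s * u (k + 1)) * (Q ^ (k - 2) * X ^ (r + 1 - k)))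
      - w * X ^ r * (\<Sum>k=2..r + 1. (- s) ^ (k - 2) * (u k + s * u (k + 1)))
      - v * (X - y) * (\<Sum>k=2..r + 1. p ^ (r + 2 - k) * (Q ^ (k - 2) * X ^ (r + 1 - k)))
      + v * X ^ r * (\<Sum>k=2..r + 1. p ^ (r + 2 - k) * (- s) ^ (k - 2))"
    unfolding sum_distrib_left sum.distrib[symmetric] sum_subtractf[symmetric] D_def
    by (intro sum.cong refl) (simp add: algebra_simps)
  finally have S: "(\<Sum>m=0..r - 1. c_par r q u m * X ^ m) = \<dots>" .
  define H where "H = (\<Sum>k=2..r + 1. (u k + s * u (k + 1)) * (Q ^ (k - 2) * X ^ (r + 1 - k)))"
  define B where "B = (\<Sum>k=2..r + 1. u k * (Q ^ (k - 2) * X ^ (r + 1 - k)))"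
  define g where "g = (\<Sum>k=2..r + 1. p ^ (r + 2 - k) * (Q ^ (k - 2) * X ^ (r + 1 - k)))"
  define e where "e = (\<Sum>k=2..r + 1. p ^ (r + 2 - k) * (- s) ^ (k - 2))"
  have H: "Q * H = B + (Q - 1) * X ^ (r - 1) * u 2 + s * Q ^ r * v"
    unfolding H_def B_def v_def Q_def using assms(4) by (rule H_identity)
  have g: "V * (X - y) * g = X ^ r * p ^ r - Q ^ r"
    using geometric_sum_u1[OF assms(1,2), of X r]
    by (simp add: g_def V_def Q_def p_def s_def y_def w_def power_divide)
  have e: "V * e = p ^ r - (- s) ^ r"
  proof -
    have "e = p * (\<Sum>k=2..r + 1. p ^ (r + 1 - k) * (- s) ^ (k - 2))"
      unfolding e_def sum_distrib_left by (intro sum.cong refl) (auto simp: Suc_diff_le)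
    moreover have "V * p = p - (- s)" using assms(1) by (simp add: V_def p_def field_simps)
    ultimately have "V * e = (p - (- s)) * (\<Sum>k=2..r + 1. p ^ (r + 1 - k) * (- s) ^ (k - 2))"
      by (metis mult.assoc)
    thus ?thesis by (simp only: geometric_sum_2)
  qed
  have Vw: "V * w = 1" using V0 by (simp add: w_def)
  have Xr: "X ^ r = X * X ^ (r - 1)" using assms(4) by (metis power_eq_if not_one_le_zero)
  have sy: "s * (X - y) + Q = w"
  proof -
    have "s * (X - y) + Q = 1 - s * y" by (simp add: Q_def algebra_simps)
    also have "\<dots> = w * (V - s * u 1)" using Vw by (simp add: y_def algebra_simps)
    finally show ?thesis by (simp add: V_def)
  qed
  \<comment> \<open>The p^r parts of \<open>g\<close> and \<open>e\<close> cancel, and the (-s)^r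
    part of \<open>e\<close> cancels the one left by \<open>telescope_u\<close>. The surviving
    multiples of v Q^r combine through \<open>sy\<close>.\<close>
  have "Q * V * ((\<Sum>m=0..r - 1. c_par r q u m * X ^ m) + u 1 * u 2 / V ^ 2 * X ^ (r - 1)) =
     (V * w) * ((X - y) * (Q * H)) - (V * w) * (Q * X ^ r * (u 2 - (- s) ^ r * v))
      - v * Q * (V * (X - y) * g) + v * Q * X ^ r * (V * e) + (V * w) * (y * u 2 * Q * X ^ (r - 1))"
    unfolding S telescope_u H_def[symmetric] g_def[symmetric] e_def[symmetric] v_def[symmetric]
    by (simp add: y_def w_def power2_eq_square algebra_simps)
  also have "\<dots> = B * (X - y) - u 2 * X ^ (r - 1) * (X - y) + v * Q ^ r * (s * (X - y) + Q)"
    unfolding Vw H g e unfolding Xr by (simp add: algebra_simps)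
  also have "\<dots> = F_num r q u X - u 2 * X ^ (r - 1) * (X - y)"
    unfolding sy F_num_def y by (simp add: B_def Q_def s_def v_def w_def V_def)
  finally show ?thesis unfolding y by (simp add: Q_def V_def s_def)
qed

subsection \<open>\<open>q\<close>-Stirling expansion\<close>

text \<open>The q-falling factorial [n][n-1]...[n-j+1]. For j > n the factor with i = n is [0] = 0,
  so it vanishes despite truncated subtraction.\<close>

definition qfall :: "'a::field \<Rightarrow> nat \<Rightarrow> nat \<Rightarrow> 'a" where
  "qfall q n j = (\<Prod>i<j. qint q (n - i))"

lemma qint_0 [simp]: "qint q 0 = (0::'a::field)"
  by (simp add: qint_def)

lemma qint_mult: "q \<noteq> 1 \<Longrightarrow> (1 - q) * qint q n = 1 - (q::'a::field) ^ n"
  by (simp add: qint_def)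

text \<open>For j \<le> n this is [n+1] = [j+1] + q^(j+1) [n-j]; otherwise both falling factorials
  vanish.\<close>

lemma qint_Suc_times_qfall:
  fixes q :: "'a::field"
  assumes "q \<noteq> 1"
  shows "qint q (Suc n) * qfall q n j = qint q (Suc j) * qfall q n j + q ^ Suc j * qfall q n (Suc j)"
proof (cases "j \<le> n")
  case True
  have "Suc n = Suc j + (n - j)" using True by simp
  hence "q ^ Suc n = q ^ Suc j * q ^ (n - j)" by (metis power_add)
  moreover have "(1 - A * B) / d = (1 - A) / d + A * ((1 - B) / d)" for A B d :: 'a
    by (simp add: diff_divide_distrib algebra_simps)
  ultimately have "qint q (Suc n) = qint q (Suc j) + q ^ Suc j * qint q (n - j)"
    by (simp only: qint_def)
  thus ?thesis by (simp add: qfall_def algebra_simps)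
next
  case False
  hence "qfall q n j = 0" by (auto simp: qfall_def intro!: bexI[of _ n])
  moreover have "qfall q n (Suc j) = 0" using False by (auto simp: qfall_def intro!: bexI[of _ n])
  ultimately show ?thesis by simp
qed

lemma qStirling_eq_0: "n < k \<Longrightarrow> qStirling q n k = 0"
  by (cases n; cases k) auto

text \<open>The usual expansion of [n+1]^(m+1) in falling factorials of [n+1], with the common
  factor [n+1] removed; hence the shifts by one in the Stirling numbers.\<close>

lemma qint_power_eq_qStirling:
  fixes q :: "'a::field"
  assumes "q \<noteq> 1"
  shows "qint q (Suc n) ^ m = (\<Sum>j=0..m. qStirling q (m + 1) (j + 1) * qfall q n j)"
proof (induction m)
  case 0
  show ?case by (simp add: qfall_def)
next
  case (Suc m)
  define S where "S = qStirling q (m + 1)"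
  have S: "qStirling q (Suc m + 1) (j + 1) = q ^ j * S j + qint q (j + 1) * S (j + 1)" if "j \<le> Suc m" for j
    using that by (simp add: S_def)
  have S0: "S 0 = 0" "S (m + 2) = 0" by (auto simp: S_def qStirling_eq_0)
  have "qint q (Suc n) ^ Suc m = (\<Sum>j=0..m. S (j + 1) * (qint q (Suc n) * qfall q n j))"
    by (simp add: Suc.IH S_def sum_distrib_left mult_ac)
  also have "\<dots> = (\<Sum>j=0..m. qint q (j + 1) * S (j + 1) * qfall q n j) +
      (\<Sum>j=0..m. q ^ (j + 1) * S (j + 1) * qfall q n (j + 1))"
    unfolding qint_Suc_times_qfall[OF assms] sum.distrib[symmetric]
    by (intro sum.cong refl) (simp add: algebra_simps)
  also have "(\<Sum>j=0..m. qint q (j + 1) * S (j + 1) * qfall q n j) =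
      (\<Sum>j=0..Suc m. qint q (j + 1) * S (j + 1) * qfall q n j)"
    using S0(2) by simp
  also have "(\<Sum>j=0..m. q ^ (j + 1) * S (j + 1) * qfall q n (j + 1)) =
      (\<Sum>j=0..Suc m. q ^ j * S j * qfall q n j)"
    using S0(1) by (simp only: sum.atLeast0_atMost_Suc_shift) simp
  also have "(\<Sum>j=0..Suc m. qint q (j + 1) * S (j + 1) * qfall q n j) + \<dots> =
      (\<Sum>j=0..Suc m. qStirling q (Suc m + 1) (j + 1) * qfall q n j)"
    unfolding sum.distrib[symmetric]
    by (intro sum.cong refl, subst S) (auto simp: algebra_simps)
  finally show ?case .
qed

lemma A_par_sum:
  fixes q :: "'a::field"
  assumes "q \<noteq> 1" "r \<ge> 1"
  shows "(\<Sum>j=0..r - 1. A_par r q u j * qfall q n j) =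
    (\<Sum>m=0..r - 1. c_par r q u m * qint q (Suc n) ^ m) +
    u 1 * u 2 / (1 + (1 - q) * u 1) ^ 2 * qint q (Suc n) ^ (r - 1)"
proof -
  have "(\<Sum>m=0..r - 1. c_par r q u m * qint q (Suc n) ^ m) =
      (\<Sum>m=0..r - 1. \<Sum>j=0..m. c_par r q u m * qStirling q (m + 1) (j + 1) * qfall q n j)"
    by (simp add: qint_power_eq_qStirling[OF assms(1)] sum_distrib_left mult.assoc)
  also have "\<dots> = (\<Sum>j=0..r - 1. \<Sum>m=j..r - 1. c_par r q u m * qStirling q (m + 1) (j + 1) * qfall q n j)"
    by (subst (1 2) sum.Sigma, simp, simp, simp, simp,
        rule sum.reindex_bij_witness[of _ "\<lambda>(a, b). (b, a)" "\<lambda>(a, b). (b, a)"]) auto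
  finally show ?thesis
    using assms(2) qint_power_eq_qStirling[OF assms(1), of n "r - 1"]
    by (simp add: A_par_def distrib_right sum.distrib sum_distrib_right sum_distrib_left mult.assoc)
qed

subsection \<open>Terms of the hypergeometric series\<close>

lemma qpochs_map:
  fixes q :: "'a::comm_ring_1"
  shows "qpochs q (map (\<lambda>i. a i * q ^ j) [1..<r + 2]) n = (\<Prod>k<n. \<Prod>i=1..r + 1. 1 - a i * q ^ (j + k))"
proof -
  have "qpochs q (map (\<lambda>i. a i * q ^ j) [1..<r + 2]) n = (\<Prod>i\<in>{1..<r + 2}. qpoch q (a i * q ^ j) n)"
    using prod.distinct_set_conv_list[of "[1..<r + 2]" "\<lambda>i. qpoch q (a i * q ^ j) n"]
    by (simp add: qpochs_def o_def del: upt_Suc prod.op_ivl_Suc)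
  also have "{1..<r + 2} = {1..r + 1}" by auto
  finally show ?thesis unfolding qpoch_def by (subst prod.swap) (simp add: power_add mult.assoc)
qed

text \<open>Factor by factor, from (1-q) [k+e] = 1 - q^(k+e). The exponent e is 1 for the a_i and 2
  for the b_i.\<close>

lemma prod_one_minus:
  fixes q :: "'a::field"
  assumes "q \<noteq> 1" "(\<Prod>i=1..n. 1 + (1 - q) * f i) \<noteq> 0"
  shows "(\<Prod>i=1..n. 1 - q ^ e / (1 + (1 - q) * f i) * q ^ k) =
    (1 - q) ^ n * (\<Prod>i=1..n. qint q (k + e) + f i) / (\<Prod>i=1..n. 1 + (1 - q) * f i)"
proof -
  have "(\<Prod>i=1..n. 1 - q ^ e / (1 + (1 - q) * f i) * q ^ k) =
      (\<Prod>i=1..n. (1 - q) * (qint q (k + e) + f i) / (1 + (1 - q) * f i))"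
  proof (intro prod.cong refl)
    fix i assume "i \<in> {1..n}"
    hence nz: "1 + (1 - q) * f i \<noteq> 0" using assms(2) by auto
    have "(1 - q) * (qint q (k + e) + f i) = 1 + (1 - q) * f i - q ^ e * q ^ k"
      unfolding distrib_left qint_mult[OF assms(1)] by (simp add: power_add)
    thus "1 - q ^ e / (1 + (1 - q) * f i) * q ^ k = (1 - q) * (qint q (k + e) + f i) / (1 + (1 - q) * f i)"
      by (simp only: diff_divide_distrib divide_self[OF nz] times_divide_eq_left)
  qed
  thus ?thesis by (simp add: prod_dividef prod.distrib)
qed

text \<open>The assumptions \<open>Ca\<close> and \<open>Cb\<close> rule out that some a_i or b_i is
  0 through division by zero.\<close>

locale phi_params =
  fixes q :: "'a::field" and r :: nat and \<alpha> \<beta> a b :: "nat \<Rightarrow> 'a"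
  assumes q0: "q \<noteq> 0" and q1: "\<And>n. n \<ge> 1 \<Longrightarrow> q ^ n \<noteq> 1"
    and Ca: "(\<Prod>i=1..r + 1. 1 + (1 - q) * \<alpha> i) \<noteq> 0"
    and Cb: "(\<Prod>i=1..r + 1. 1 + (1 - q) * \<beta> i) \<noteq> 0"
    and a: "\<And>i. a i = q / (1 + (1 - q) * \<alpha> i)"
    and b: "\<And>i. b i = q ^ 2 / (1 + (1 - q) * \<beta> i)"
begin

definition "Ea n = (\<Prod>i=1..r + 1. qint q n + \<alpha> i)"
definition "Eb n = (\<Prod>i=1..r + 1. qint q n + \<beta> i)"
definition "z = (\<Prod>i=1..r + 1. b i) / (q ^ r * (\<Prod>i=1..r + 1. a i))"

lemma q_neq_1: "q \<noteq> 1" using q1[of 1] by simp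

lemma qint_neq_0: "n \<ge> 1 \<Longrightarrow> qint q n \<noteq> 0"
  using q1[of n] q_neq_1 by (auto simp: qint_def)

lemma z_eq: "z = q * (\<Prod>i=1..r + 1. 1 + (1 - q) * \<alpha> i) / (\<Prod>i=1..r + 1. 1 + (1 - q) * \<beta> i)"
proof -
  define A B where "A = (\<Prod>i=1..r + 1. 1 + (1 - q) * \<alpha> i)" and "B = (\<Prod>i=1..r + 1. 1 + (1 - q) * \<beta> i)"
  have nz: "A \<noteq> 0" "B \<noteq> 0" unfolding A_def B_def by (rule Ca Cb)+
  have 1: "(\<Prod>i=1..r + 1. a i) = q ^ (r + 1) / A" "(\<Prod>i=1..r + 1. b i) = (q ^ 2) ^ (r + 1) / B"
    unfolding a b A_def B_def by (simp_all add: prod_dividef del: prod.cl_ivl_Suc)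
  have 2: "(q ^ 2) ^ (r + 1) = q * (q ^ r * q ^ (r + 1))"
    by (simp add: power2_eq_square power_mult_distrib)
  have 3: "q * (c * d) / B / (c * (d / A)) = q * A / B" if "c \<noteq> 0" "d \<noteq> 0" for c d
    using that nz by (simp add: field_simps)
  show ?thesis unfolding z_def 1 2 A_def[symmetric] B_def[symmetric] by (rule 3) (use q0 in auto)
qed

text \<open>The normalizing constants of numerator and denominator factors differ by A/B, and z is q
  A/B, so each k leaves just one q. The different powers of q in a_i and b_i shift the arguments of
  \<open>Ea\<close> and \<open>Eb\<close> by one against each other.\<close>

lemma qpochs_quotient:
  "qpochs q (map (\<lambda>i. a i * q ^ j) [1..<r + 2]) n / qpochs q (map (\<lambda>i. b i * q ^ j) [1..<r + 2]) n * z ^ n =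
    q ^ n * (\<Prod>k<n. Ea (j + k + 1) / Eb (j + k + 2))"
proof -
  define A B s where "A = (\<Prod>i=1..r + 1. 1 + (1 - q) * \<alpha> i)" and "B = (\<Prod>i=1..r + 1. 1 + (1 - q) * \<beta> i)"
    and "s = (1 - q) ^ (r + 1)"
  have nz: "A \<noteq> 0" "B \<noteq> 0" "s \<noteq> 0" using Ca Cb q_neq_1 by (simp_all add: A_def B_def s_def del: prod.cl_ivl_Suc)
  have zAB: "z = q * A / B" unfolding A_def B_def by (rule z_eq)
  have 1: "(\<Prod>i=1..r + 1. 1 - a i * q ^ (j + k)) = s * Ea (j + k + 1) / A" for k
    using prod_one_minus[OF q_neq_1 Ca, of 1 "j + k"] by (simp only: a s_def A_def Ea_def power_one_right)
  have 2: "(\<Prod>i=1..r + 1. 1 - b i * q ^ (j + k)) = s * Eb (j + k + 2) / B" for k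
    using prod_one_minus[OF q_neq_1 Cb, of 2 "j + k"] by (simp only: b s_def B_def Eb_def)
  have "qpochs q (map (\<lambda>i. a i * q ^ j) [1..<r + 2]) n / qpochs q (map (\<lambda>i. b i * q ^ j) [1..<r + 2]) n * z ^ n =
      (\<Prod>k<n. s * Ea (j + k + 1) / A) / (\<Prod>k<n. s * Eb (j + k + 2) / B) * (\<Prod>k<n. z)"
    unfolding qpochs_map 1 2 by simp
  also have "\<dots> = (\<Prod>k<n. (s * Ea (j + k + 1) / A) / (s * Eb (j + k + 2) / B) * z)"
    by (simp only: prod_dividef prod.distrib)
  also have "\<dots> = (\<Prod>k<n. q * (Ea (j + k + 1) / Eb (j + k + 2)))"
    using nz by (intro prod.cong refl) (simp add: zAB)
  finally show ?thesis by (simp only: prod.distrib prod_constant card_lessThan)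
qed

lemma phi_term_eq:
  "phi_term q (q ^ (j + 1) # map (\<lambda>i. a i * q ^ j) [1..<r + 2]) (map (\<lambda>i. b i * q ^ j) [1..<r + 2]) z n =
    qpoch q (q ^ (j + 1)) n / qpoch q q n * (q ^ n * (\<Prod>k<n. Ea (j + k + 1) / Eb (j + k + 2)))"
  unfolding qpochs_quotient[symmetric] phi_term_def by (simp add: qpochs_def del: upt_Suc)

lemma qpoch_q: "qpoch q (q ^ (j + 1)) n = (1 - q) ^ n * (\<Prod>k<n. qint q (j + k + 1))"
proof -
  have "qpoch q (q ^ (j + 1)) n = (\<Prod>k<n. (1 - q) * qint q (j + k + 1))"
    unfolding qpoch_def qint_mult[OF q_neq_1] by (simp add: power_add mult_ac)
  thus ?thesis by (simp add: prod.distrib)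
qed

lemma B_par_eq:
  "B_par r q a b j = q ^ (j + 1) * (\<Prod>k<j. qint q (k + 1)) * (\<Prod>k<j. Ea (k + 1) / Eb (k + 2))"
proof -
  have 1: "qpochs q (q # map a [1..<r+2]) j = qpoch q q j * qpochs q (map (\<lambda>i. a i * q ^ 0) [1..<r + 2]) j"
    by (simp add: qpochs_def del: upt_Suc)
  have 2: "(\<Prod>i=1..r + 1. b i) / (q ^ r * (1 - q) * (\<Prod>i=1..r + 1. a i)) = z / (1 - q)"
    by (simp add: z_def del: prod.cl_ivl_Suc)
  have "B_par r q a b j = q * qpoch q q j / (1 - q) ^ j *
      (qpochs q (map (\<lambda>i. a i * q ^ 0) [1..<r + 2]) j / qpochs q (map (\<lambda>i. b i * q ^ 0) [1..<r + 2]) j * z ^ j)"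
    unfolding B_par_def 1 2 power_divide by (simp add: mult_ac del: upt_Suc)
  thus ?thesis unfolding qpochs_quotient using qpoch_q[of 0 j] q_neq_1 by simp
qed

text \<open>With N = j + n the result depends on j only through \<open>qfall q N j\<close>. Terms of
  all r series with the same N therefore share one factor and can be summed by
  \<open>A_par_sum\<close>.\<close>

lemma B_par_phi_term:
  "B_par r q a b j * phi_term q (q ^ (j + 1) # map (\<lambda>i. a i * q ^ j) [1..<r + 2])
      (map (\<lambda>i. b i * q ^ j) [1..<r + 2]) z n =
   q ^ (j + n + 1) * qfall q (j + n) j * (\<Prod>k<j + n. Ea (k + 1) / Eb (k + 2))"
proof -
  define P where "P m = (\<Prod>k<m. qint q (k + 1))" for m
  have P: "P m \<noteq> 0" for m unfolding P_def using qint_neq_0 by auto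
  have split: "(\<Prod>k<m + n. h k) = (\<Prod>k<m. h k) * (\<Prod>k<n. h (m + k))" for h :: "nat \<Rightarrow> 'a" and m n
    by (induction n) (simp_all add: mult.assoc)
  have fall: "qfall q (j + n) j = (\<Prod>k<j. qint q (n + k + 1))"
    unfolding qfall_def
    by (rule prod.reindex_bij_witness[of _ "\<lambda>k. j - 1 - k" "\<lambda>k. j - 1 - k"])
       (auto intro!: arg_cong[where f = "qint q"])
  \<comment> \<open>Both sides are [1][2]...[j+n].\<close>
  have eq: "P j * (\<Prod>k<n. qint q (j + k + 1)) = P n * qfall q (j + n) j"
    using split[of "\<lambda>k. qint q (k + 1)" j n] split[of "\<lambda>k. qint q (k + 1)" n j]
    unfolding P_def fall by (simp add: add.commute)
  have "qpoch q (q ^ (j + 1)) n / qpoch q q n = (\<Prod>k<n. qint q (j + k + 1)) / P n"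
    using qpoch_q[of j n] qpoch_q[of 0 n] q_neq_1 by (simp add: P_def)
  also have "\<dots> = qfall q (j + n) j / P j" using eq P by (simp add: field_simps)
  finally have 1: "qpoch q (q ^ (j + 1)) n / qpoch q q n = qfall q (j + n) j / P j" .
  show ?thesis
    unfolding phi_term_eq B_par_eq 1 P_def[symmetric] split[of _ j n]
    using P[of j] by (simp add: power_add mult_ac)
qed

end

section \<open>The main identity\<close>

subsection \<open>Passing to the field\<close>

locale embedding =
  fixes \<iota> :: "pseries \<Rightarrow> 'l::field" and q t :: 'l and u :: "nat \<Rightarrow> 'l"
  assumes embedding: "ring_embedding \<iota>"
    and q: "q = \<iota> q_ser" and t: "t = \<iota> t_ser" and u: "\<And>i. u i = \<iota> (u_ser i)"
begin

lemma inj: "inj \<iota>" using embedding by (simp add: ring_embedding_def)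

lemma emb_1: "\<iota> 1 = 1"
  and emb_add: "\<iota> (f + g) = \<iota> f + \<iota> g"
  and emb_mult: "\<iota> (f * g) = \<iota> f * \<iota> g"
  using embedding by (auto simp: ring_embedding_def)

lemma emb_0: "\<iota> 0 = 0" using emb_add[of 0 0] by (metis add.right_neutral add_left_cancel)

lemma emb_diff: "\<iota> (f - g) = \<iota> f - \<iota> g"
  using emb_add[of "f - g" g] by simp

lemma emb_power: "\<iota> (f ^ n) = \<iota> f ^ n"
  by (induction n) (simp_all add: emb_1 emb_mult)

lemma emb_sum: "\<iota> (sum f A) = (\<Sum>i\<in>A. \<iota> (f i))"
  by (induction A rule: infinite_finite_induct) (simp_all add: emb_0 emb_add)

lemma emb_prod: "\<iota> (prod f A) = (\<Prod>i\<in>A. \<iota> (f i))"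
  by (induction A rule: infinite_finite_induct) (simp_all add: emb_1 emb_mult)

lemmas emb = emb_0 emb_1 emb_add emb_mult emb_diff emb_power emb_sum emb_prod

lemma emb_eq_0_iff: "\<iota> f = 0 \<longleftrightarrow> f = 0"
  using inj emb_0 by (metis injD)

lemma emb_inverse:
  assumes "f * g = 1"
  shows "\<iota> f \<noteq> 0" "\<iota> g = 1 / \<iota> f"
proof -
  have *: "\<iota> f * \<iota> g = 1" using assms by (simp flip: emb_mult add: emb_1)
  thus "\<iota> f \<noteq> 0" by auto
  with * show "\<iota> g = 1 / \<iota> f" by (simp add: eq_divide_eq mult.commute)
qed

lemma emb_const_nonzero:
  assumes "mcoeff f {#} \<noteq> 0" shows "\<iota> f \<noteq> 0"
  using assms by (auto simp: emb_eq_0_iff)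

lemma emb_mconst_inverse:
  assumes "fps_nth c 0 \<noteq> 0"
  shows "\<iota> (mconst c) \<noteq> 0" "\<iota> (mconst (inverse c)) = 1 / \<iota> (mconst c)"
  using emb_inverse[of "mconst c" "mconst (inverse c)"] inverse_mult_eq_1'[OF assms]
  by (simp_all add: mconst_mult[symmetric])

lemma emb_mgeom:
  assumes "order_ge 1 f"
  shows "1 - \<iota> f \<noteq> 0" "\<iota> (mgeom f) = 1 / (1 - \<iota> f)"
  using emb_inverse[OF mgeom[OF assms]] by (simp_all add: emb)

lemma q_neq_0: "q \<noteq> 0" unfolding q by (rule emb_const_nonzero) (simp add: mcoeff_mconst)

lemma one_minus_q_power: "1 - q ^ n = \<iota> (mconst (1 - fps_X ^ n))"
  by (simp add: q emb mconst_diff mconst_power)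

lemma q_power_neq_1: "n \<ge> 1 \<Longrightarrow> q ^ n \<noteq> 1"
  using emb_mconst_inverse(1)[of "1 - fps_X ^ n"] one_minus_q_power[of n] by auto

lemma q_neq_1: "q \<noteq> 1" using q_power_neq_1[of 1] by simp

lemma emb_qint: "\<iota> (mconst (qint fps_X n)) = qint q n"
proof -
  have "(1 - q) * \<iota> (mconst (qint fps_X n)) = 1 - q ^ n"
    using one_minus_q_power[of 1]
    by (simp only: one_minus_q_power power_one_right emb_mult[symmetric] mconst_mult[symmetric] qint_fps_X_mult)
  thus ?thesis using q_neq_1 by (simp add: qint_def field_simps)
qed

lemma qint_neq_0: "n \<ge> 1 \<Longrightarrow> qint q n \<noteq> 0"
  using q_power_neq_1[of n] q_neq_1 by (simp add: qint_def)

lemma emb_zfac: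
  assumes "m \<ge> 1" shows "\<iota> (mconst (zfac m k)) = (q ^ m) ^ (k - 1) / qint q m ^ k"
proof -
  have "\<iota> (mconst (inverse (qint fps_X m))) = 1 / qint q m"
    using emb_mconst_inverse(2)[of "qint fps_X m"] qint_fps_X_nth_0[OF assms] by (simp add: emb_qint)
  thus ?thesis using assms
    by (simp add: zfac_eq mconst_mult mconst_power emb q power_mult[symmetric] power_divide mult.commute)
qed

lemma u1_neq_0: "u 1 \<noteq> 0"
proof -
  have "mcoeff (u_ser 1) {#U 1#} = (1 :: rat fps)" by (simp add: mvar_def)
  hence "u_ser 1 \<noteq> 0" by (metis mcoeff_zero zero_neq_one)
  thus ?thesis by (simp add: u emb_eq_0_iff)
qed

section \<open>The denominators of F_n in the field\<close>

definition "V = 1 + (1 - q) * u 1"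

lemma V: "V \<noteq> 0" "1 / V \<in> range \<iota>" "V \<in> range \<iota>"
proof -
  have o: "order_ge 1 ((q_ser - 1) * u_ser 1)" by (rule order_ge_cmult_var)
  have e: "1 - \<iota> ((q_ser - 1) * u_ser 1) = V" unfolding V_def by (simp add: q u emb algebra_simps)
  show "V \<noteq> 0" using emb_mgeom(1)[OF o] unfolding e .
  show "1 / V \<in> range \<iota>" using emb_mgeom(2)[OF o] unfolding e by (rule range_eqI[OF sym])
  have "V = \<iota> (1 + (1 - q_ser) * u_ser 1)" unfolding V_def by (simp add: q u emb)
  thus "V \<in> range \<iota>" by simp
qed

lemma V0: "1 + (1 - q) * u 1 \<noteq> 0" using V(1) by (simp add: V_def)

definition "x1 = u 1 / V"

lemma x_par_1: "x_par r q u 1 = x1"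
  by (simp only: x_par_one x1_def V_def)

lemma V_times: "V * (X - x1) = X - u 1 * (1 - (1 - q) * X)"
  using V(1) by (simp add: x1_def field_simps) (simp add: V_def algebra_simps)

lemma q_power_eq: "q ^ n = 1 - (1 - q) * qint q n"
  using qint_mult[OF q_neq_1, of n] by simp

text \<open>V (X - x_1) = X (1 - u_1 q^n/X) with X = [n], and the last factor is inverted by a
  geometric series in the ring; in particular it is nonzero.\<close>

lemma linear_factor:
  assumes "n \<ge> 1"
  shows "qint q n - x1 \<noteq> 0"
    "\<iota> (mgeom (mconst (fps_X ^ n / qint fps_X n) * u_ser 1)) = qint q n / (V * (qint q n - x1))"
proof -
  define X where "X = qint q n"
  define y where "y = mconst (fps_X ^ n / qint fps_X n) * u_ser 1"
  have X: "X \<noteq> 0" unfolding X_def by (rule qint_neq_0[OF assms])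
  have yX: "\<iota> y = q ^ n / X * u 1"
    using emb_mconst_inverse(2)[of "qint fps_X n"] qint_fps_X_nth_0[OF assms]
    by (simp add: y_def X_def fps_divide_unit mconst_mult emb emb_qint u q mconst_power)
  have "V * (X - x1) = X - u 1 * q ^ n"
    by (simp only: V_times q_power_eq[of n] X_def)
  hence y: "1 - \<iota> y = V * (X - x1) / X"
    using X by (simp add: yX diff_divide_distrib mult.commute)
  have o: "order_ge 1 y" unfolding y_def by (rule order_ge_cmult_var)
  show "qint q n - x1 \<noteq> 0" using emb_mgeom(1)[OF o] y by (auto simp: X_def)
  show "\<iota> (mgeom (mconst (fps_X ^ n / qint fps_X n) * u_ser 1)) = qint q n / (V * (qint q n - x1))"
    using emb_mgeom(2)[OF o] unfolding y unfolding y_def X_def by simp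
qed

definition "lin r n = qint q n ^ r * (qint q n - x1)"

lemma lin_neq_0: "n \<ge> 1 \<Longrightarrow> lin r n \<noteq> 0"
  using linear_factor(1) qint_neq_0 by (simp add: lin_def)

lemma emb_F_ser:
  assumes "n \<ge> 1"
  shows "lin r n * \<iota> (F_ser r n) = F_num r q u (qint q n)"
proof -
  define X Q where "X = qint q n" and "Q = q ^ n"
  have X: "X \<noteq> 0" "X - x1 \<noteq> 0"
    unfolding X_def by (rule qint_neq_0[OF assms] linear_factor[OF assms])+
  have Q: "1 - (1 - q) * X = Q" by (simp add: Q_def X_def q_power_eq)
  have F: "\<iota> (F_ser r n) = (\<Sum>k=1..r. Q ^ (k - 1) / X ^ k * u (k + 1)) +
      Q ^ r / X ^ (r + 1) * u (r + 2) * (X / (V * (X - x1)))"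
    using linear_factor(2)[OF assms] assms
    by (simp add: F_ser_def emb emb_zfac u X_def[symmetric] Q_def[symmetric])
  have "X ^ r * (\<Sum>k=1..r. Q ^ (k - 1) / X ^ k * u (k + 1)) =
      (\<Sum>k=2..r + 1. u k * (Q ^ (k - 2) * X ^ (r + 1 - k)))"
    unfolding sum_distrib_left
  proof (rule sum.reindex_bij_witness[of _ "\<lambda>k. k - 1" "\<lambda>k. k + 1"])
    fix k assume k: "k \<in> {1..r}"
    have "X ^ r = X ^ (r - k) * X ^ k" using k by (simp flip: power_add)
    thus "u (k + 1) * (Q ^ (k + 1 - 2) * X ^ (r + 1 - (k + 1))) = X ^ r * (Q ^ (k - 1) / X ^ k * u (k + 1))"
      using X(1) by simp
  qed auto
  moreover have "X ^ r * (X - x1) * (Q ^ r / X ^ (r + 1) * u (r + 2) * (X / (V * (X - x1)))) =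
      u (r + 2) * Q ^ r / V"
    using X V(1) by (simp add: field_simps)
  moreover have "X ^ r * (X - x1) * (A + B) = (X ^ r * A) * (X - x1) + X ^ r * (X - x1) * B" for A B
    by (simp add: algebra_simps)
  ultimately show ?thesis
    unfolding lin_def F_num_def x_par_1 X_def[symmetric] F Q V_def[symmetric] by simp
qed

lemma emb_D_ser:
  "1 - t * \<iota> (F_ser r n) \<noteq> 0" "\<iota> (D_ser r n) = 1 / (1 - t * \<iota> (F_ser r n))"
  using emb_mgeom[OF order_ge_t_F_ser[of r n]] by (simp_all add: D_ser_def emb t)

lemma emb_G_ser:
  assumes "r \<ge> 1" "n \<ge> 1"
  shows "lin r n * \<iota> (G_ser r n) = F_num r q u (qint q n) - u 2 * qint q n ^ (r - 1) * (qint q n - x1)"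
proof -
  define X where "X = qint q n"
  have X: "X \<noteq> 0" unfolding X_def by (rule qint_neq_0[OF assms(2)])
  have "X ^ r = X * X ^ (r - 1)" using assms(1) by (metis power_eq_if not_one_le_zero)
  hence "lin r n * (1 / X * u 2) = u 2 * X ^ (r - 1) * (X - x1)"
    using X by (simp add: lin_def X_def[symmetric])
  moreover have "\<iota> (G_ser r n) = \<iota> (F_ser r n) - 1 / X * u 2"
    using assms(2) emb_zfac[OF assms(2), of 1] by (simp add: G_ser_def emb u X_def)
  ultimately show ?thesis using emb_F_ser[OF assms(2), of r] by (simp add: right_diff_distrib X_def)
qed

text \<open>For X = 1/(1-q) each factor is (1-q)(X + f_i), so the product can be read off from the
  polynomial. There 1 - (1-q) X = 0, \<open>F_num\<close> shrinks to its k = 2 term, and what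
  remains is a nonzero multiple of 1 + (1-q) c u_2. As c lies in the ring, this has constant term
  1.\<close>

lemma roots_at_infinity:
  assumes "r \<ge> 1" "c \<in> range \<iota>"
    and "\<And>X. (\<Prod>i=1..r + 1. X + f i) = X ^ r * (X - x1) + c * F_num r q u X"
  shows "(\<Prod>i=1..r + 1. 1 + (1 - q) * f i) \<noteq> 0"
proof -
  define s X where "s = 1 - q" and "X = 1 / s"
  have s: "s \<noteq> 0" using q_neq_1 by (simp add: s_def)
  have X: "X \<noteq> 0" using s by (simp add: X_def)
  have "s * V * (X - x1) = V - s * u 1"
    using s V(1) by (simp add: X_def x1_def field_simps)
  hence "s * V * (X - x1) = 1" by (simp add: V_def s_def)
  hence Xx: "X - x1 \<noteq> 0" by auto
  obtain c' where c': "c = \<iota> c'" using assms(2) by auto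
  have "1 + s * (c * u 2) = \<iota> (1 + (1 - q_ser) * (c' * u_ser 2))"
    by (simp add: emb s_def c' q u)
  moreover have "order_ge 1 ((1 - q_ser) * (c' * u_ser 2))" by (intro order_ge_mult_left order_ge_cmult_var)
  hence "mcoeff ((1 - q_ser) * (c' * u_ser 2)) {#} = 0" by (simp only: order_ge_1_iff)
  ultimately have nz: "1 + s * (c * u 2) \<noteq> 0"
    using emb_const_nonzero[of "1 + (1 - q_ser) * (c' * u_ser 2)"] by (simp add: mcoeff_one)
  have Q: "1 - (1 - q) * X = 0" using s by (simp add: X_def s_def[symmetric])
  have F: "F_num r q u X = u 2 * X ^ (r - 1) * (X - x1)"
  proof -
    have "(\<Sum>k=2..r + 1. u k * (0 ^ (k - 2) * X ^ (r + 1 - k))) =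
        (\<Sum>k\<in>{2}. u k * (0 ^ (k - 2) * X ^ (r + 1 - k)))"
      using assms(1) by (intro sum.mono_neutral_right) auto
    thus ?thesis using assms(1) by (simp only: F_num_def Q x_par_1) (simp add: numeral_2_eq_2)
  qed
  have Xr: "X ^ r = X * X ^ (r - 1)" using assms(1) by (metis power_eq_if not_one_le_zero)
  have "s * (\<Prod>i=1..r + 1. X + f i) = (s * X + s * (c * u 2)) * (X ^ (r - 1) * (X - x1))"
    unfolding assms(3) F Xr by (simp add: algebra_simps)
  also have "s * X = 1" using s by (simp add: X_def)
  also have "(1 + s * (c * u 2)) * (X ^ (r - 1) * (X - x1)) \<noteq> 0" using nz X Xx by simp
  finally have "(\<Prod>i=1..r + 1. X + f i) \<noteq> 0" by auto
  moreover have "1 + (1 - q) * f i = s * (X + f i)" for i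
    using s by (simp add: X_def s_def[symmetric] distrib_left)
  ultimately show ?thesis using s by (simp add: prod.distrib del: prod.cl_ivl_Suc)
qed

section \<open>Membership in the image of the series ring\<close>

lemma range_add: "y \<in> range \<iota> \<Longrightarrow> z \<in> range \<iota> \<Longrightarrow> y + z \<in> range \<iota>"
  and range_diff: "y \<in> range \<iota> \<Longrightarrow> z \<in> range \<iota> \<Longrightarrow> y - z \<in> range \<iota>"
  and range_mult: "y \<in> range \<iota> \<Longrightarrow> z \<in> range \<iota> \<Longrightarrow> y * z \<in> range \<iota>"
  and range_power: "y \<in> range \<iota> \<Longrightarrow> y ^ n \<in> range \<iota>"
  by (auto simp flip: emb_add emb_diff emb_mult emb_power)

lemma range_0: "0 \<in> range \<iota>" and range_1: "1 \<in> range \<iota>"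
  using emb_0 emb_1 by (metis rangeI)+

lemma range_prod: "(\<And>i. i \<in> A \<Longrightarrow> f i \<in> range \<iota>) \<Longrightarrow> prod f A \<in> range \<iota>"
  by (induction A rule: infinite_finite_induct) (auto intro: range_mult range_1)

lemma range_of_nat: "of_nat n \<in> range \<iota>"
  by (induction n) (auto intro: range_add range_0 range_1)

lemma range_base: "q \<in> range \<iota>" "t \<in> range \<iota>" "u i \<in> range \<iota>" "qint q n \<in> range \<iota>"
  using emb_qint[of n] by (auto simp: q t u) (metis rangeI)

lemma range_x1: "x1 \<in> range \<iota>"
  using range_mult[OF range_base(3) V(2), of 1] by (simp add: x1_def)

lemma range_mconst_inverse: "fps_nth c 0 \<noteq> 0 \<Longrightarrow> 1 / \<iota> (mconst c) \<in> range \<iota>"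
  using emb_mconst_inverse(2)[of c] by (metis rangeI)

lemma range_inverse_qint: "n \<ge> 1 \<Longrightarrow> 1 / qint q n \<in> range \<iota>"
  using range_mconst_inverse[of "qint fps_X n"] qint_fps_X_nth_0[of n] by (simp add: emb_qint)

lemma range_inverse_one_minus_q: "1 / (1 - q) \<in> range \<iota>"
  using range_mconst_inverse[of "1 - fps_X ^ 1"] one_minus_q_power[of 1] by simp

lemma range_inverse_lin:
  assumes "n \<ge> 1" shows "1 / lin r n \<in> range \<iota>"
proof -
  \<comment> \<open>The inverse of X - x_1 is taken from A/(V L), the image of a geometric
    series.\<close>
  have "1 / (A ^ r * L) = (1 / A) ^ Suc r * V * (A / (V * L))" if "A \<noteq> 0" for A L
    using that V(1) by (simp add: power_divide)
  hence "1 / lin r n = (1 / qint q n) ^ Suc r * V * (qint q n / (V * (qint q n - x1)))"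
    unfolding lin_def using qint_neq_0[OF assms] by blast
  also have "\<dots> \<in> range \<iota>"
    unfolding linear_factor(2)[OF assms, symmetric]
    by (intro range_mult range_power range_inverse_qint assms V rangeI)
  finally show ?thesis .
qed

text \<open>The coefficients \<open>A\<^sub>j\<close> are only visibly elements of the localization of the series ring at \<open>u\<^sub>1\<close>.\<close>

definition "localized = {z. \<exists>K. u 1 ^ K * z \<in> range \<iota>}"

lemma localized_mono: "u 1 ^ K * z \<in> range \<iota> \<Longrightarrow> K \<le> L \<Longrightarrow> u 1 ^ L * z \<in> range \<iota>"
  using range_mult[OF range_power[OF range_base(3)], of "u 1 ^ K * z" 1 "L - K"]
  by (simp add: mult.assoc[symmetric] power_add[symmetric])

lemma range_localized: "z \<in> range \<iota> \<Longrightarrow> z \<in> localized"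
  unfolding localized_def by (intro CollectI exI[of _ 0]) simp

lemma localized_add:
  assumes "y \<in> localized" "z \<in> localized" shows "y + z \<in> localized"
proof -
  obtain K L where KL: "u 1 ^ K * y \<in> range \<iota>" "u 1 ^ L * z \<in> range \<iota>"
    using assms by (auto simp: localized_def)
  have "u 1 ^ (K + L) * y + u 1 ^ (K + L) * z \<in> range \<iota>"
    by (intro range_add localized_mono[OF KL(1)] localized_mono[OF KL(2)]) auto
  thus ?thesis unfolding localized_def distrib_left[symmetric] by blast
qed

lemma localized_mult:
  assumes "y \<in> localized" "z \<in> localized" shows "y * z \<in> localized"
proof -
  obtain K L where KL: "u 1 ^ K * y \<in> range \<iota>" "u 1 ^ L * z \<in> range \<iota>"
    using assms by (auto simp: localized_def)
  have "u 1 ^ (K + L) * (y * z) \<in> range \<iota>"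
    using range_mult[OF KL] by (simp add: power_add mult_ac)
  thus ?thesis unfolding localized_def by blast
qed

lemma localized_diff: "y \<in> localized \<Longrightarrow> z \<in> localized \<Longrightarrow> y - z \<in> localized"
  using localized_add[OF _ localized_mult[OF range_localized, of "- 1"], of y z] range_diff[OF range_0 range_1]
  by simp

lemma localized_sum: "(\<And>i. i \<in> A \<Longrightarrow> f i \<in> localized) \<Longrightarrow> sum f A \<in> localized"
  by (induction A rule: infinite_finite_induct) (auto intro: localized_add range_localized range_0)

lemma localized_power: "z \<in> localized \<Longrightarrow> z ^ n \<in> localized"
  by (induction n) (auto intro: localized_mult range_localized range_1)

lemma localized_powi: "z \<in> localized \<Longrightarrow> 1 / z \<in> localized \<Longrightarrow> z powi n \<in> localized"
  by (simp add: power_int_def localized_power inverse_eq_divide)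

lemma localized_inverse_u1: "1 / u 1 \<in> localized"
  unfolding localized_def using u1_neq_0 range_1 by (intro CollectI exI[of _ 1]) simp

lemma localized_common:
  assumes "finite J" "\<And>j. j \<in> J \<Longrightarrow> f j \<in> localized"
  shows "\<exists>K. \<forall>j\<in>J. u 1 ^ K * f j \<in> range \<iota>"
  using assms
proof (induction J rule: finite_induct)
  case (insert j J)
  have "\<exists>K. \<forall>j\<in>J. u 1 ^ K * f j \<in> range \<iota>"
    by (rule insert.IH) (simp add: insert.prems)
  moreover have "\<exists>L. u 1 ^ L * f j \<in> range \<iota>"
    using insert.prems[of j] by (simp add: localized_def)
  ultimately obtain K L where KL: "\<forall>j\<in>J. u 1 ^ K * f j \<in> range \<iota>" "u 1 ^ L * f j \<in> range \<iota>"
    by auto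
  have "u 1 ^ (K + L) * f i \<in> range \<iota>" if "i \<in> insert j J" for i
    using that KL localized_mono[of K "f i" "K + L"] localized_mono[of L "f i" "K + L"] by auto
  thus ?case by blast
qed simp

text \<open>1 - q and V are units of the ring, so only the negative powers of u_1 require
  localization.\<close>

lemma localized_c_par: "c_par r q u m \<in> localized"
proof -
  have "1 / (- (1 - q)) = 0 - 1 / (1 - q)" by (simp only: divide_minus_right diff_0)
  hence "1 / (- (1 - q)) \<in> range \<iota>"
    by (simp only: range_diff[OF range_0 range_inverse_one_minus_q])
  moreover have "- (1 - q) \<in> range \<iota>" using range_diff[OF range_base(1) range_1] by simp
  ultimately have s: "(- (1 - q)) powi n \<in> localized" for n
    by (intro localized_powi range_localized)
  have v: "z / V \<in> localized" if "z \<in> range \<iota>" for z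
    using range_localized[OF range_mult[OF that V(2)]] by simp
  show ?thesis unfolding c_par_def V_def[symmetric]
    by (intro localized_sum localized_mult[of _ "_ powi _"] localized_mult[of "_ * _"] s
        localized_add localized_diff v range_mult range_diff range_base range_1 localized_powi
        localized_inverse_u1 range_localized[OF range_of_nat] range_localized[OF range_base(3)]
        localized_mult)
qed

lemma range_qStirling: "qStirling q n k \<in> range \<iota>"
proof (induction n arbitrary: k)
  case 0
  show ?case by (cases k) (simp_all add: range_0 range_1 del: imageE)
next
  case (Suc n)
  show ?case by (cases k) (simp_all add: range_add range_mult range_power range_base range_0 Suc)
qed

lemma localized_A_par: "A_par r q u j \<in> localized"
proof -
  have "u 1 * u 2 / V ^ 2 = u 1 * u 2 * (1 / V) ^ 2" by (simp add: power_divide)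
  also have "\<dots> \<in> range \<iota>" by (intro range_mult range_power range_base V)
  finally show ?thesis unfolding A_par_def V_def[symmetric]
    by (intro localized_add localized_sum localized_mult localized_c_par range_localized range_qStirling)
qed

end

locale psi_identity = embedding \<iota> q t u for \<iota> :: "pseries \<Rightarrow> 'l::field" and q t u +
  fixes r :: nat and x \<alpha> \<beta> a b :: "nat \<Rightarrow> 'l"
  assumes r: "r \<ge> 1"
    and x: "\<And>j. x j = x_par r q u j"
    and sum_\<alpha>: "(\<Sum>i=1..r+1. \<alpha> i) = (1 - t) * x 2 - x 1"
    and esym_\<alpha>: "\<And>j. j \<in> {2..r+1} \<Longrightarrow> esym (r + 1) j \<alpha> = (1 - t) * (x (j + 1) - x 1 * x j)"
    and sum_\<beta>: "(\<Sum>i=1..r+1. \<beta> i) = - (x 1 + t * x 2)"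
    and esym_\<beta>: "\<And>j. j \<in> {2..r+1} \<Longrightarrow> esym (r + 1) j \<beta> = - t * (x (j + 1) - x 1 * x j)"
    and a: "\<And>i. a i = q / (1 + (1 - q) * \<alpha> i)"
    and b: "\<And>i. b i = q ^ 2 / (1 + (1 - q) * \<beta> i)"
begin

lemma prod_\<alpha>: "(\<Prod>i=1..r + 1. X + \<alpha> i) = X ^ r * (X - x1) + (1 - t) * F_num r q u X"
  using prod_roots[where u = u and q = q and r = r and c = "1 - t" and f = \<alpha> and X = X, OF u1_neq_0 V0 r]
    sum_\<alpha> esym_\<alpha> unfolding x x_par_1 by blast

lemma prod_\<beta>: "(\<Prod>i=1..r + 1. X + \<beta> i) = X ^ r * (X - x1) + (- t) * F_num r q u X"
proof (rule prod_roots[where u = u and q = q and r = r and c = "- t" and f = \<beta> and X = X,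
      OF u1_neq_0 V0 r, unfolded x_par_1])
  show "(\<Sum>i=1..r+1. \<beta> i) = - t * x_par r q u 2 - x1"
    unfolding sum_\<beta> x x_par_1 by simp
qed (use esym_\<beta> in \<open>unfold x x_par_1, blast\<close>)

sublocale phi_params q r \<alpha> \<beta> a b
proof
  show "(\<Prod>i=1..r + 1. 1 + (1 - q) * \<alpha> i) \<noteq> 0"
    by (rule roots_at_infinity[OF r _ prod_\<alpha>]) (intro range_diff range_1 range_base)
  show "(\<Prod>i=1..r + 1. 1 + (1 - q) * \<beta> i) \<noteq> 0"
    using range_diff[OF range_0 range_base(2)] by (intro roots_at_infinity[OF r _ prod_\<beta>]) simp
qed (use a b q_neq_0 q_power_neq_1 in auto)

text \<open>Up to the common denominator, \<open>Ea\<close> and \<open>Eb\<close> are the two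
  factors in the product formula of the generating function.\<close>

lemma Ea_eq: "n \<ge> 1 \<Longrightarrow> Ea n = lin r n * (1 + (1 - t) * \<iota> (F_ser r n))"
  unfolding Ea_def prod_\<alpha> emb_F_ser[symmetric] by (simp add: lin_def algebra_simps)

lemma Eb_eq: "n \<ge> 1 \<Longrightarrow> Eb n = lin r n * (1 - t * \<iota> (F_ser r n))"
  unfolding Eb_def prod_\<beta> emb_F_ser[symmetric] by (simp add: lin_def algebra_simps)

lemma range_Ea: "n \<ge> 1 \<Longrightarrow> Ea n \<in> range \<iota>"
  unfolding Ea_eq lin_def
  by (intro range_mult range_power range_add range_diff range_base range_1 range_x1 rangeI)

lemma range_inverse_Eb: "n \<ge> 1 \<Longrightarrow> 1 / Eb n \<in> range \<iota>"
proof -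
  assume n: "n \<ge> 1"
  have "1 / Eb n = 1 / lin r n * \<iota> (D_ser r n)"
    by (simp add: Eb_eq[OF n] emb_D_ser(2))
  thus "1 / Eb n \<in> range \<iota>" using range_inverse_lin[OF n] by (simp only: range_mult rangeI)
qed

lemma range_ratio: "Ea (i + k + 1) / Eb (i + k + 2) \<in> range \<iota>"
  using range_mult[OF range_Ea range_inverse_Eb, of "i + k + 1" "i + k + 2"] by simp

lemma range_B_par: "B_par r q a b j \<in> range \<iota>"
  unfolding B_par_eq using range_ratio[of 0]
  by (intro range_mult range_power range_base range_prod) simp_all

definition "\<phi> j = phi_term q (q ^ (j + 1) # map (\<lambda>i. a i * q ^ j) [1..<r+2]) (map (\<lambda>i. b i * q ^ j) [1..<r+2]) z"

text \<open>The explicit factor q^n gives q-adic convergence. The rest lies in the ring because 1 -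
  q, the [k] and the values of \<open>Eb\<close> at positive arguments have inverses there.\<close>

lemma phi_term_range: "\<exists>h. \<forall>n. \<phi> j n = \<iota> (q_ser ^ n * h n)"
proof -
  have "\<exists>h. \<phi> j n = \<iota> (q_ser ^ n * h)" for n
  proof -
    have "1 / qpoch q q n = (1 / (1 - q)) ^ n * (\<Prod>k<n. 1 / qint q (k + 1))"
      using qpoch_q[of 0 n] by (simp add: prod_dividef power_divide)
    hence 1: "1 / qpoch q q n \<in> range \<iota>"
      by (simp only: range_mult range_power range_inverse_one_minus_q range_prod range_inverse_qint le_add2)
    have 2: "qpoch q (q ^ (j + 1)) n \<in> range \<iota>"
      unfolding qpoch_q by (intro range_mult range_power range_diff range_1 range_base range_prod)
    have 3: "(\<Prod>k<n. Ea (j + k + 1) / Eb (j + k + 2)) \<in> range \<iota>"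
      by (intro range_prod range_ratio)
    obtain h where "qpoch q (q ^ (j + 1)) n * (1 / qpoch q q n) * (\<Prod>k<n. Ea (j + k + 1) / Eb (j + k + 2)) = \<iota> h"
      using range_mult[OF range_mult[OF 2 1] 3] by auto
    thus ?thesis unfolding \<phi>_def phi_term_eq by (intro exI[of _ h]) (simp add: emb q mult_ac)
  qed
  thus ?thesis by metis
qed

text \<open>At m = 1 one has [m] = 1 and q^m = q, and V times \<open>Eb 1\<close> is exactly the
  denominator on the left.\<close>

lemma prefactor:
  "V ^ 2 / (1 - q * u 1 - t * (1 - q * u 1) * (\<Sum>k=2..r+1. q ^ (k - 2) * u k) - t * q ^ r * u (r + 2)) =
    V / Eb 1"
proof -
  define S where "S = (\<Sum>k=2..r + 1. q ^ (k - 2) * u k)"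
  have S: "(\<Sum>k=2..r + 1. u k * (q ^ (k - 2) * 1 ^ (r + 1 - k))) = S"
    unfolding S_def by (intro sum.cong refl) simp
  have 1: "qint q 1 = 1" using q_neq_1 by (simp add: qint_def)
  have "1 - (1 - q) * 1 = q" by simp
  hence "F_num r q u 1 = S * (1 - x1) + u (r + 2) * q ^ r / V"
    by (simp only: F_num_def x_par_1 V_def S)
  hence "Eb 1 = (1 - x1) - t * (S * (1 - x1) + u (r + 2) * q ^ r / V)"
    unfolding Eb_def 1 prod_\<beta> by simp
  moreover have "V * ((1 - x1) - t * (S * (1 - x1) + d)) = V * (1 - x1) - t * (V * (1 - x1)) * S - t * (V * d)" for d
    by (simp add: algebra_simps)
  moreover have "t * (V * (u (r + 2) * q ^ r / V)) = t * q ^ r * u (r + 2)"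
    using V(1) by simp
  ultimately have "V * Eb 1 = V * (1 - x1) - t * (V * (1 - x1)) * S - t * q ^ r * u (r + 2)"
    by (simp only:)
  also have "V * (1 - x1) = 1 - q * u 1" unfolding V_times by simp
  finally have "V * Eb 1 = 1 - q * u 1 - t * (1 - q * u 1) * S - t * q ^ r * u (r + 2)" .
  thus ?thesis unfolding S_def[symmetric] power2_eq_square
    using mult_divide_mult_cancel_left[OF V(1), of V "Eb 1"] by simp
qed

text \<open>Termwise form of the theorem: the summand with m = N + 1 is shared among the r series,
  the j-th supplying its term N - j.\<close>

lemma emb_W_ser:
  "\<iota> (W_ser r (Suc N)) = (\<Sum>j=0..r - 1. V / Eb 1 * A_par r q u j * B_par r q a b j *
     (if j \<le> N then \<phi> j (N - j) else 0))"
proof -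
  \<comment> \<open>Regrouping pairs the numerator at k + 1 with the denominator at k + 2, as in the
    hypergeometric terms; \<open>Eb 1\<close> stays behind and becomes part of the
    prefactor.\<close>
  have ratio: "(\<Prod>m=1..N. Ea m / Eb m) / Eb (Suc N) = (\<Prod>k<N. Ea (k + 1) / Eb (k + 2)) / Eb 1" for N
  proof (induction N)
    case (Suc N)
    have "(\<Prod>m=1..Suc N. Ea m / Eb m) / Eb (Suc (Suc N)) =
        (\<Prod>m=1..N. Ea m / Eb m) / Eb (Suc N) * (Ea (N + 1) / Eb (N + 2))"
      by simp
    also have "\<dots> = (\<Prod>k<Suc N. Ea (k + 1) / Eb (k + 2)) / Eb 1"
      unfolding Suc.IH by simp
    finally show ?case .
  qed simp
  have P: "\<iota> (P_ser r N) = (\<Prod>m=1..N. Ea m / Eb m)"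
  proof -
    have "\<iota> (P_ser r N) = (\<Prod>m=1..N. (1 + (1 - t) * \<iota> (F_ser r m)) / (1 - t * \<iota> (F_ser r m)))"
      by (simp add: P_ser_def emb t[symmetric] emb_D_ser(2))
    also have "\<dots> = (\<Prod>m=1..N. Ea m / Eb m)"
      by (intro prod.cong refl) (simp add: Ea_eq Eb_eq lin_neq_0)
    finally show ?thesis .
  qed
  define S where "S = (\<Sum>j=0..r - 1. A_par r q u j * qfall q N j)"
  have G: "lin r (Suc N) * \<iota> (G_ser r (Suc N)) = q ^ Suc N * V * S"
  proof -
    have "lin r (Suc N) * \<iota> (G_ser r (Suc N)) = F_num r q u (qint q (Suc N)) -
        u 2 * qint q (Suc N) ^ (r - 1) * (qint q (Suc N) - x1)"
      by (rule emb_G_ser[OF r]) simp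
    also have "\<dots> = (1 - (1 - q) * qint q (Suc N)) * (1 + (1 - q) * u 1) * S"
      unfolding S_def A_par_sum[OF q_neq_1 r] x_par_1[of r, symmetric]
      by (rule c_par_polynomial[where u = u and q = q and r = r, OF u1_neq_0 V0 q_neq_1 r, symmetric])
    finally show ?thesis by (simp only: q_power_eq V_def)
  qed
  have D: "\<iota> (G_ser r (Suc N)) * \<iota> (D_ser r (Suc N)) = q ^ Suc N * V * S / Eb (Suc N)"
    unfolding G[symmetric] emb_D_ser(2) using lin_neq_0[of "Suc N" r] by (simp add: Eb_eq)
  have "\<iota> (W_ser r (Suc N)) = q ^ Suc N * V * S * ((\<Prod>m=1..N. Ea m / Eb m) / Eb (Suc N))"
    by (simp add: W_ser_def emb_mult D P)
  also have "\<dots> = (\<Sum>j=0..r - 1. V / Eb 1 * A_par r q u j *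
      (q ^ Suc N * qfall q N j * (\<Prod>k<N. Ea (k + 1) / Eb (k + 2))))"
    unfolding ratio S_def sum_distrib_left sum_distrib_right by (intro sum.cong refl) (simp add: mult_ac)
  also have "\<dots> = (\<Sum>j=0..r - 1. V / Eb 1 * A_par r q u j * B_par r q a b j *
     (if j \<le> N then \<phi> j (N - j) else 0))"
  proof (intro sum.cong refl)
    fix j
    have "q ^ Suc N * qfall q N j * (\<Prod>k<N. Ea (k + 1) / Eb (k + 2)) =
        B_par r q a b j * (if j \<le> N then \<phi> j (N - j) else 0)"
    proof (cases "j \<le> N")
      case True
      thus ?thesis using B_par_phi_term[of j "N - j"] by (simp add: \<phi>_def)
    next
      case False
      \<comment> \<open>The vanishing falling factorial agrees with the value 0 given to terms
        before the start of the j-th series.\<close>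
      hence "qfall q N j = 0" by (auto simp: qfall_def intro!: bexI[of _ N])
      thus ?thesis using False by simp
    qed
    thus "V / Eb 1 * A_par r q u j * (q ^ Suc N * qfall q N j * (\<Prod>k<N. Ea (k + 1) / Eb (k + 2))) =
        V / Eb 1 * A_par r q u j * B_par r q a b j * (if j \<le> N then \<phi> j (N - j) else 0)"
      by (simp only: mult.assoc)
  qed
  finally show ?thesis .
qed

lemma identity:
  "(\<forall>j. \<exists>s. formal_sums \<iota> (\<phi> j) s) \<and>
   \<iota> (Psi0 r) = V / Eb 1 * (\<Sum>j=0..r-1. A_par r q u j * B_par r q a b j * formal_suminf \<iota> (\<phi> j))"
proof -
  obtain h where h: "\<And>j n. \<phi> j n = \<iota> (q_ser ^ n * h j n)"
    using phi_term_range by metis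
  have "\<exists>G. q_sums (\<lambda>n. q_ser ^ n * h j n) G" for j
    by (rule q_sums_exists) (rule q_order_ge_X_power)
  then obtain G where G: "\<And>j. q_sums (\<lambda>n. q_ser ^ n * h j n) (G j)" by metis
  have conv: "formal_sums \<iota> (\<phi> j) (\<iota> (G j))" for j
    using G h by (rule formal_sumsI)
  have val: "formal_suminf \<iota> (\<phi> j) = \<iota> (G j)" for j
    using inj G h by (rule formal_suminf_eqI)
  have "V / Eb 1 \<in> range \<iota>" using range_mult[OF V(3) range_inverse_Eb[of 1]] by simp
  hence "V / Eb 1 * A_par r q u j * B_par r q a b j \<in> localized" for j
    by (intro localized_mult localized_A_par range_localized range_B_par)
  \<comment> \<open>A single power of u_1 clears the denominators of all coefficients. The term
    identity can then be pulled back along \<iota>, and uniqueness of q-adic sums applies in the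
    ring; u_1 is cancelled afterwards in the field.\<close>
  hence "\<exists>K. \<forall>j\<in>{0..r - 1}. u 1 ^ K * (V / Eb 1 * A_par r q u j * B_par r q a b j) \<in> range \<iota>"
    by (intro localized_common) auto
  then obtain K where "\<forall>j\<in>{0..r - 1}. \<exists>y. u 1 ^ K * (V / Eb 1 * A_par r q u j * B_par r q a b j) = \<iota> y"
    unfolding image_iff by blast
  then obtain y where y: "\<And>j. j \<in> {0..r - 1} \<Longrightarrow> u 1 ^ K * (V / Eb 1 * A_par r q u j * B_par r q a b j) = \<iota> (y j)"
    unfolding bchoice_iff by blast
  define g where "g j N = (if j \<le> N then q_ser ^ (N - j) * h j (N - j) else 0)" for j N
  have "u_ser 1 ^ K * W_ser r (Suc N) = (\<Sum>j=0..r - 1. y j * g j N)" for N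
  proof (rule injD[OF inj])
    have "\<iota> (u_ser 1 ^ K * W_ser r (Suc N)) = (\<Sum>j=0..r - 1.
        u 1 ^ K * (V / Eb 1 * A_par r q u j * B_par r q a b j) * (if j \<le> N then \<phi> j (N - j) else 0))"
      by (simp add: emb_mult emb_power u[symmetric] emb_W_ser sum_distrib_left mult.assoc)
    also have "\<dots> = (\<Sum>j=0..r - 1. \<iota> (y j) * \<iota> (g j N))"
      by (intro sum.cong refl) (simp only: y, simp add: g_def h emb_0)
    finally show "\<iota> (u_ser 1 ^ K * W_ser r (Suc N)) = \<iota> (\<Sum>j=0..r - 1. y j * g j N)"
      by (simp add: emb_sum emb_mult)
  qed
  moreover have "q_sums (\<lambda>N. u_ser 1 ^ K * W_ser r (Suc N)) (u_ser 1 ^ K * Psi0 r)"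
    by (intro q_sums_cmult q_sums_Psi0 r)
  moreover have "q_sums (\<lambda>N. \<Sum>j=0..r - 1. y j * g j N) (\<Sum>j=0..r - 1. y j * G j)"
    unfolding g_def by (intro q_sums_sum q_sums_cmult q_sums_shift G)
  ultimately have "u_ser 1 ^ K * Psi0 r = (\<Sum>j=0..r - 1. y j * G j)"
    using q_sums_unique by simp
  hence "\<iota> (u_ser 1 ^ K * Psi0 r) = \<iota> (\<Sum>j=0..r - 1. y j * G j)" by simp
  hence "u 1 ^ K * \<iota> (Psi0 r) = (\<Sum>j=0..r - 1. \<iota> (y j) * \<iota> (G j))"
    by (simp only: emb u)
  also have "\<dots> = u 1 ^ K * (V / Eb 1 * (\<Sum>j=0..r-1. A_par r q u j * B_par r q a b j * \<iota> (G j)))"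
    unfolding sum_distrib_left by (intro sum.cong refl) (simp only: y[symmetric] mult.assoc)
  finally have "\<iota> (Psi0 r) = V / Eb 1 * (\<Sum>j=0..r-1. A_par r q u j * B_par r q a b j * \<iota> (G j))"
    using mult_left_cancel[OF power_not_zero[OF u1_neq_0]] by blast
  thus ?thesis using conv val by auto
qed

end

theorem mainTheorem1:
  fixes \<iota> :: "pseries \<Rightarrow> 'l::field"
    and r :: nat
    and q t :: 'l and u x \<alpha> \<beta> a b :: "nat \<Rightarrow> 'l"
  assumes "ring_embedding \<iota>"
    and "r \<ge> 1"
    and "q = \<iota> q_ser" and "t = \<iota> t_ser" and "\<And>i. u i = \<iota> (u_ser i)"
    and "\<And>j. x j = x_par r q u j"
    and "(\<Sum>i=1..r+1. \<alpha> i) = (1 - t) * x 2 - x 1"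
    and "\<And>j. j \<in> {2..r+1} \<Longrightarrow> esym (r + 1) j \<alpha> = (1 - t) * (x (j + 1) - x 1 * x j)"
    and "(\<Sum>i=1..r+1. \<beta> i) = - (x 1 + t * x 2)"
    and "\<And>j. j \<in> {2..r+1} \<Longrightarrow> esym (r + 1) j \<beta> = - t * (x (j + 1) - x 1 * x j)"
    and "\<And>i. a i = q / (1 + (1 - q) * \<alpha> i)"
    and "\<And>i. b i = q ^ 2 / (1 + (1 - q) * \<beta> i)"
  shows "(\<forall>j<r. phi_converges \<iota> q (q ^ (j + 1) # map (\<lambda>i. a i * q ^ j) [1..<r+2])
            (map (\<lambda>i. b i * q ^ j) [1..<r+2])
            ((\<Prod>i=1..r+1. b i) / (q ^ r * (\<Prod>i=1..r+1. a i)))) \<and>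
    \<iota> (Psi0 r) =
      (1 + (1 - q) * u 1) ^ 2 /
        (1 - q * u 1 - t * (1 - q * u 1) * (\<Sum>k=2..r+1. q ^ (k - 2) * u k) - t * q ^ r * u (r + 2)) *
      (\<Sum>j=0..r-1. A_par r q u j * B_par r q a b j *
        phi \<iota> q (q ^ (j + 1) # map (\<lambda>i. a i * q ^ j) [1..<r+2])
          (map (\<lambda>i. b i * q ^ j) [1..<r+2])
          ((\<Prod>i=1..r+1. b i) / (q ^ r * (\<Prod>i=1..r+1. a i))))"
proof -
  interpret psi_identity \<iota> q t u r x \<alpha> \<beta> a b
    by unfold_locales (fact assms)+
  show ?thesis
    using identity unfolding prefactor[symmetric]
    unfolding \<phi>_def phi_converges_def phi_def z_def V_def by blast
qed

end
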